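(* For any graph $\Gamma$ there is a tropical rational function $Z_\Gamma$ in indeterminates indexed by the vertices of $\Gamma$ such that for any family $\mathfrak k=\{\mathfrak k_v\}_{v\in V(\Gamma)}$ of non-negative integers and for any odd prime $p$, the order of the $p$-torsion (that is, $p$-primary torsion) subgroup of $H^1(\Gamma,p^{\mathfrak k})$ equals the evaluation $Z_\Gamma(p^{\mathfrak k})$ of $Z_\Gamma$ at $\{p^{\mathfrak k_v}\}_{v}$ in the tropical semiring of non-negative numbers with tropical sum $\mathrm{GCD}$ and tropical product the ordinary product. (Equivalently, the order is $p^{Z_\Gamma(\mathfrak k)}$, with $Z_\Gamma(\mathfrak k)$ evaluated in $\mathbf Z\cup\{\infty\}$ with tropical sum $\min$ and tropical product $+$.)
   Context: Graphs are finite, without loops or multiple edges; $e(v,w)$ denotes the edge joining $v,w$. For a graph $\Gamma$ with a positive integer weight $k_v$ at each vertex, $C^*(\Gamma,\mathbf k)$ is the cochain complex with $C^0=\mathbf Z[V(\Gamma)]$, $C^1=\mathbf Z[E(\Gamma)]$, $d^0(v)=\sum_{w} k_w\, e(v,w)$ (sum over neighbours $w$ of $v$), and $H^*(\Gamma,\mathbf k)$ is its cohomology. $p^{\mathfrak k}$ denotes the weights $p^{\mathfrak k_v}$. Tropical semirings: on $\mathbf Z\cup\{\infty\}$ put $a\oplus b=\min(a,b)$, $a\odot b=a+b$. On $\mathbf N\cup\{0\}\subset\mathbf Q_+\cup\{0\}$ put $a\oplus b=\mathrm{GCD}(a,b)$, $a\odot b=ab$ (for positive rationals, $\mathrm{GCD}$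 is given by the minimum of $q$-adic valuations at each prime $q$). In $\mathbf Z\cup\{\infty\}$ and $\mathbf Q_+\cup\{0\}$ every element other than the tropical zero ($\infty$, resp. $0$) has a tropical multiplicative inverse, giving a tropical quotient $a\oslash b$; evaluations of quotients are made there. For each prime $p$, $n\mapsto p^n$ is a semiring homomorphism $\mathbf Z\cup\{\infty\}\to\mathbf Q_+\cup\{0\}$. For a finite set $A$, a tropical monomial in $A$ is an iterated tropical product of variables $a\in A$ with non-negative integer exponents; a tropical polynomial is a tropical sum of a finite set of tropical monomials; a tropical rational function is a tropical quotient of two tropical polynomials. *)

theory Defs
  imports
    "HOL-Algebra.Free_Abelian_Groups"
    "HOL-Algebra.Ring"
    "HOL-Computational_Algebra.Primes"
    "HOL-Library.Extended"
begin

section \<open>Graph cohomology with vertex weights\<close>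

text \<open>The edge joining \<open>v\<close> and \<open>w\<close> is the two-element set \<open>{v, w}\<close>.\<close>

definition finite_simple_graph :: "'a set \<Rightarrow> 'a set set \<Rightarrow> bool" where
  "finite_simple_graph V E \<longleftrightarrow> finite V \<and> (\<forall>e\<in>E. e \<subseteq> V \<and> card e = 2)"

definition coboundary0 ::
  "'a set \<Rightarrow> 'a set set \<Rightarrow> ('a \<Rightarrow> nat) \<Rightarrow> ('a \<Rightarrow>\<^sub>0 int) \<Rightarrow> ('a set \<Rightarrow>\<^sub>0 int)" where
  "coboundary0 V E k =
     frag_extend (\<lambda>v. \<Sum>w\<in>{w \<in> V. {v, w} \<in> E}. frag_cmul (int (k w)) (frag_of {v, w}))"

text \<open>The complex is concentrated in degrees 0 and 1, so every 1-cochain is a cocycle.\<close>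

definition graph_H1 ::
  "'a set \<Rightarrow> 'a set set \<Rightarrow> ('a \<Rightarrow> nat) \<Rightarrow> ('a set \<Rightarrow>\<^sub>0 int) set monoid" where
  "graph_H1 V E k =
     free_Abelian_group E Mod (coboundary0 V E k ` carrier (free_Abelian_group V))"

definition primary_torsion :: "nat \<Rightarrow> ('g, 'm) monoid_scheme \<Rightarrow> 'g set" where
  "primary_torsion p G = {x \<in> carrier G. \<exists>n::nat. x [^]\<^bsub>G\<^esub> (p ^ n) = \<one>\<^bsub>G\<^esub>}"


section \<open>Tropical semirings\<close>

text \<open>
  Both tropical semirings are records of the algebraic hierarchy: \<open>add\<close> and \<open>mult\<close> are the tropical
  sum and product, \<open>zero\<close> and \<open>one\<close> their neutral elements. Tropical quotients use the
  multiplicative inverse of the record. The value \<open>-\<infinity>\<close> of type \<open>int extended\<close> is outside the carrier.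
\<close>

definition trop_min :: "int extended ring" where
  "trop_min = \<lparr>carrier = - {-\<infinity>}, monoid.mult = (+), one = 0, zero = \<infinity>, add = min\<rparr>"

definition rat_val :: "nat \<Rightarrow> rat \<Rightarrow> int" where
  "rat_val q x = (case quotient_of x of (a, b) \<Rightarrow>
     int (multiplicity (int q) a) - int (multiplicity (int q) b))"

definition rat_gcd :: "rat \<Rightarrow> rat \<Rightarrow> rat" where
  "rat_gcd x y =
     (if x = 0 then y else if y = 0 then x
      else THE g. g > 0 \<and> (\<forall>q. prime q \<longrightarrow> rat_val q g = min (rat_val q x) (rat_val q y)))"

definition trop_gcd :: "rat ring" where
  "trop_gcd = \<lparr>carrier = {x. x \<ge> 0}, monoid.mult = (*), one = 1, zero = 0, add = rat_gcd\<rparr>"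

definition trop_power :: "nat \<Rightarrow> int extended \<Rightarrow> rat" where
  "trop_power p x = (case x of Fin n \<Rightarrow> of_nat p powi n | _ \<Rightarrow> 0)"


section \<open>Tropical polynomials and rational functions\<close>

text \<open>
  A monomial is its exponent vector, a polynomial the finite set of its monomials (the empty set is
  the tropical zero), and a rational function the pair of numerator and nonzero denominator.
\<close>

type_synonym 'a trop_monom = "'a \<Rightarrow>\<^sub>0 nat"
type_synonym 'a trop_poly = "'a trop_monom set"

definition trop_polynomial :: "'a set \<Rightarrow> 'a trop_poly \<Rightarrow> bool" where
  "trop_polynomial A P \<longleftrightarrow> finite P \<and> (\<forall>m\<in>P. Poly_Mapping.keys m \<subseteq> A)"

definition trop_rational_function :: "'a set \<Rightarrow> 'a trop_poly \<times> 'a trop_poly \<Rightarrow> bool" where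
  "trop_rational_function A Z \<longleftrightarrow>
     trop_polynomial A (fst Z) \<and> trop_polynomial A (snd Z) \<and> snd Z \<noteq> {}"

definition eval_monom :: "('r, 'm) ring_scheme \<Rightarrow> ('a \<Rightarrow> 'r) \<Rightarrow> 'a trop_monom \<Rightarrow> 'r" where
  "eval_monom R x m =
     (\<Otimes>\<^bsub>R\<^esub>a\<in>Poly_Mapping.keys m. x a [^]\<^bsub>R\<^esub> Poly_Mapping.lookup m a)"

definition eval_poly :: "('r, 'm) ring_scheme \<Rightarrow> ('a \<Rightarrow> 'r) \<Rightarrow> 'a trop_poly \<Rightarrow> 'r" where
  "eval_poly R x P = (\<Oplus>\<^bsub>R\<^esub>m\<in>P. eval_monom R x m)"

definition eval_rational ::
  "('r, 'm) ring_scheme \<Rightarrow> ('a \<Rightarrow> 'r) \<Rightarrow> 'a trop_poly \<times> 'a trop_poly \<Rightarrow> 'r" where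
  "eval_rational R x Z = eval_poly R x (fst Z) \<otimes>\<^bsub>R\<^esub> inv\<^bsub>R\<^esub> eval_poly R x (snd Z)"


section \<open>Basic facts\<close>

lemma rat_val_divide:
  assumes "prime q" "a \<noteq> 0" "b \<noteq> 0"
  shows "rat_val q (of_int a / of_int b)
    = int (multiplicity (int q) a) - int (multiplicity (int q) b)"
proof -
  obtain c d where cd: "quotient_of (of_int a / of_int b) = (c, d)" by force
  have eq: "of_int a / of_int b = (of_int c / of_int d :: rat)" and d: "d > 0"
    using quotient_of_div[OF cd] quotient_of_denom_pos[OF cd] by auto
  from eq d assms(3) have "of_int (a * d) = (of_int (c * b) :: rat)"
    by (simp add: field_simps)
  hence e: "a * d = c * b" by (simp only: of_int_eq_iff)
  hence c: "c \<noteq> 0" using assms d by auto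
  have "multiplicity (int q) (a * d) = multiplicity (int q) (c * b)" using e by simp
  hence "multiplicity (int q) a + multiplicity (int q) d
       = multiplicity (int q) c + multiplicity (int q) b"
    using assms d c by (simp add: prime_elem_multiplicity_mult_distrib)
  thus ?thesis by (simp add: rat_val_def cd)
qed

lemma rat_val_unique:
  assumes "x > 0" "y > 0" "\<And>q. prime q \<Longrightarrow> rat_val q x = rat_val q y"
  shows "x = y"
proof -
  obtain a b c d where q: "quotient_of x = (a, b)" "quotient_of y = (c, d)" by force
  have x: "x = of_int a / of_int b" "b > 0" and y: "y = of_int c / of_int d" "d > 0"
    using q quotient_of_div quotient_of_denom_pos by blast+
  have ac: "a > 0" "c > 0" using assms(1,2) x y by (auto simp: zero_less_divide_iff)
  have "a * d = c * b"
  proof (rule multiplicity_eq_int)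
    fix r :: int assume r: "prime r"
    define q where "q = nat r"
    have rq: "r = int q" using prime_ge_0_int[OF r] by (simp add: q_def)
    hence "prime q" using r by simp
    have "rat_val q x = rat_val q y" using assms(3) \<open>prime q\<close> .
    thus "multiplicity r (a * d) = multiplicity r (c * b)"
      using rq r \<open>prime q\<close> ac x(2) y(2) unfolding x(1) y(1)
      by (simp add: rat_val_divide prime_elem_multiplicity_mult_distrib)
  qed (use ac x y in auto)
  hence "of_int a * of_int d = (of_int c * of_int b :: rat)" by (metis of_int_mult)
  thus ?thesis using x(2) y(2) unfolding x(1) y(1) by (simp add: frac_eq_eq)
qed

lemma rat_gcd_divide:
  assumes "a > 0" "b > 0" "c > 0"
  shows "rat_gcd (of_int a / of_int c) (of_int b / of_int c) = of_int (gcd a b) / of_int c"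
proof -
  have val: "rat_val q (of_int (gcd a b) / of_int c)
      = min (rat_val q (of_int a / of_int c)) (rat_val q (of_int b / of_int c))"
    if "prime q" for q
    using that assms
    by (simp add: rat_val_divide multiplicity_gcd min_def)
  have "(THE g. g > 0 \<and> (\<forall>q. prime q \<longrightarrow> rat_val q g
      = min (rat_val q (of_int a / of_int c)) (rat_val q (of_int b / of_int c))))
    = of_int (gcd a b) / of_int c"
    by (rule the_equality) (use val assms in \<open>auto intro!: rat_val_unique\<close>)
  thus ?thesis using assms by (simp add: rat_gcd_def)
qed

lemma rat_gcd_of_nat_divide:
  assumes "n > 0"
  shows "rat_gcd (of_nat a / of_nat n) (of_nat b / of_nat n) = of_nat (gcd a b) / of_nat n"
proof (cases "a = 0 \<or> b = 0")
  case True
  thus ?thesis using assms by (auto simp: rat_gcd_def)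
next
  case False
  hence "rat_gcd (of_int (int a) / of_int (int n)) (of_int (int b) / of_int (int n))
      = of_int (gcd (int a) (int b)) / of_int (int n)"
    using assms by (intro rat_gcd_divide) auto
  thus ?thesis by (simp only: gcd_int_int_eq of_int_of_nat_eq)
qed

lemma rat_gcd_of_nat: "rat_gcd (of_nat a) (of_nat b) = of_nat (gcd a b)"
  using rat_gcd_of_nat_divide[of 1 a b] by (simp only: of_nat_1 div_by_1 zero_less_one)

lemma nonneg_rat_cases:
  assumes "x \<ge> (0::rat)"
  obtains a n :: nat where "n > 0" "x = of_nat a / of_nat n"
proof -
  obtain a b where ab: "quotient_of x = (a, b)" by force
  have x: "x = of_int a / of_int b" "b > 0"
    using quotient_of_div[OF ab] quotient_of_denom_pos[OF ab] by auto
  hence "a \<ge> 0" using assms by (simp add: zero_le_divide_iff)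
  thus ?thesis using x that[of "nat b" "nat a"] by simp
qed

lemma common_denominator:
  fixes x y z :: rat
  assumes "x \<ge> 0" "y \<ge> 0" "z \<ge> 0"
  obtains a b c n :: nat where "n > 0" "x = of_nat a / of_nat n" "y = of_nat b / of_nat n"
    "z = of_nat c / of_nat n"
proof -
  obtain a i where a: "i > 0" "x = of_nat a / of_nat i" using assms(1) by (rule nonneg_rat_cases)
  obtain b j where b: "j > 0" "y = of_nat b / of_nat j" using assms(2) by (rule nonneg_rat_cases)
  obtain c l where c: "l > 0" "z = of_nat c / of_nat l" using assms(3) by (rule nonneg_rat_cases)
  show ?thesis
    by (rule that[of "i * j * l" "a * j * l" "b * i * l" "c * i * j"]) (use a b c in auto)
qed

lemma rat_gcd_nonneg:
  assumes "x \<ge> 0" "y \<ge> 0"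
  shows "rat_gcd x y \<ge> 0"
  by (rule common_denominator[OF assms order.refl]) (simp add: rat_gcd_of_nat_divide)

lemma rat_gcd_commute: "rat_gcd x y = rat_gcd y x"
  by (simp add: rat_gcd_def min.commute)

lemma rat_gcd_assoc:
  assumes "x \<ge> 0" "y \<ge> 0" "z \<ge> 0"
  shows "rat_gcd (rat_gcd x y) z = rat_gcd x (rat_gcd y z)"
  by (rule common_denominator[OF assms]) (simp add: rat_gcd_of_nat_divide gcd.assoc)

lemma rat_gcd_mult:
  assumes "x \<ge> 0" "y \<ge> 0" "z \<ge> 0"
  shows "z * rat_gcd x y = rat_gcd (z * x) (z * y)"
proof -
  obtain a b c n :: nat where n: "n > 0" and
    e: "x = of_nat a / of_nat n" "y = of_nat b / of_nat n" "z = of_nat c / of_nat n"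
    by (rule common_denominator[OF assms])
  have m: "z * x = of_nat (c * a) / of_nat (n * n)" "z * y = of_nat (c * b) / of_nat (n * n)"
    using n by (auto simp: e)
  have "rat_gcd (z * x) (z * y) = of_nat (gcd (c * a) (c * b)) / of_nat (n * n)"
    unfolding m by (rule rat_gcd_of_nat_divide) (use n in simp)
  also have "\<dots> = z * rat_gcd x y"
    using n by (simp add: e rat_gcd_of_nat_divide gcd_mult_distrib_nat[symmetric])
  finally show ?thesis ..
qed

lemma rat_gcd_zero: "rat_gcd 0 x = x" "rat_gcd x 0 = x"
  by (auto simp: rat_gcd_def)

lemma semiring_trop_gcd: "semiring trop_gcd"
proof -
  have r: "rat_gcd x y * z = rat_gcd (x * z) (y * z)" if "x \<ge> 0" "y \<ge> 0" "z \<ge> 0" for x y z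
    using rat_gcd_mult[OF that] by (metis mult.commute)
  have "abelian_monoid trop_gcd"
    by (intro abelian_monoidI)
      (auto simp: trop_gcd_def rat_gcd_nonneg rat_gcd_assoc rat_gcd_zero
        intro: rat_gcd_commute)
  moreover have "Group.monoid trop_gcd"
    by (intro monoidI) (simp_all add: trop_gcd_def mult.assoc)
  ultimately show ?thesis
    by (intro semiring.intro semiring_axioms.intro) (simp_all add: trop_gcd_def r rat_gcd_mult)
qed

lemma Units_trop_gcd: "Units trop_gcd = carrier trop_gcd - {\<zero>\<^bsub>trop_gcd\<^esub>}"
proof -
  have "\<exists>x\<ge>0. x * y = 1 \<and> y * x = 1" if "y \<ge> 0" "y \<noteq> 0" for y :: rat
    using that by (intro exI[of _ "inverse y"]) simp
  thus ?thesis by (auto simp: Units_def trop_gcd_def)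
qed

lemma semiring_trop_min: "semiring trop_min"
proof -
  have c: "x + y \<noteq> -\<infinity>" "min x y \<noteq> -\<infinity>"
    if "x \<noteq> -\<infinity>" "y \<noteq> -\<infinity>" for x y :: "int extended"
    using that by (cases x; cases y; simp)+
  have i: "\<infinity> + x = \<infinity>" "x + \<infinity> = \<infinity>" "min \<infinity> x = x" if "x \<noteq> -\<infinity>" for x :: "int extended"
    using that by (cases x; simp)+
  have d: "min x y + z = min (x + z) (y + z)" "z + min x y = min (z + x) (z + y)"
    if "x \<noteq> -\<infinity>" "y \<noteq> -\<infinity>" "z \<noteq> -\<infinity>" for x y z :: "int extended"
    using that by (cases x; cases y; cases z; simp)+
  have z: "-\<infinity> \<noteq> (0 :: int extended)"
    by (simp add: zero_extended_def)
  have "abelian_monoid trop_min"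
    by (intro abelian_monoidI) (auto simp: trop_min_def c i min.assoc intro: min.commute)
  moreover have "Group.monoid trop_min"
    by (intro monoidI) (simp_all add: trop_min_def c z add.assoc)
  ultimately show ?thesis
    by (intro semiring.intro semiring_axioms.intro) (simp_all add: trop_min_def d i)
qed

lemma Units_trop_min: "Units trop_min = carrier trop_min - {\<zero>\<^bsub>trop_min\<^esub>}"
proof -
  have "\<exists>x. x \<noteq> -\<infinity> \<and> x + y = 0 \<and> y + x = 0" if "y \<noteq> -\<infinity>" "y \<noteq> \<infinity>" for y :: "int extended"
    using that by (cases y) (auto simp: zero_extended_def intro!: exI[of _ "Fin (- _)"])
  moreover have "x + \<infinity> \<noteq> 0" for x :: "int extended"
    by (cases x) (auto simp: zero_extended_def)
  ultimately show ?thesis by (auto simp: Units_def trop_min_def)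
qed

lemma trop_power_hom:
  assumes "prime p" "x \<in> carrier trop_min" "y \<in> carrier trop_min"
  shows "trop_power p (x \<otimes>\<^bsub>trop_min\<^esub> y) = trop_power p x \<otimes>\<^bsub>trop_gcd\<^esub> trop_power p y"
    and "trop_power p (x \<oplus>\<^bsub>trop_min\<^esub> y) = trop_power p x \<oplus>\<^bsub>trop_gcd\<^esub> trop_power p y"
proof -
  have p: "p > 0" using assms(1) by (rule prime_gt_0_nat)
  show "trop_power p (x \<otimes>\<^bsub>trop_min\<^esub> y) = trop_power p x \<otimes>\<^bsub>trop_gcd\<^esub> trop_power p y"
    using assms(2,3) p
    by (cases x; cases y) (simp_all add: trop_min_def trop_gcd_def trop_power_def power_int_add)
  have le: "rat_gcd (of_nat p powi m) (of_nat p powi n) = of_nat p powi m" if "m \<le> n" for m n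
  proof -
    have "of_nat p powi n = of_nat p powi m * (of_nat (p ^ nat (n - m)) :: rat)"
      using that p power_int_add[of "of_nat p :: rat" m "n - m"]
      by (simp add: power_int_def)
    moreover have "rat_gcd (of_nat p powi m * of_nat 1) (of_nat p powi m * of_nat (p ^ nat (n - m)))
        = of_nat p powi m * (of_nat 1 :: rat)"
      by (subst rat_gcd_mult[symmetric]) (simp_all only: rat_gcd_of_nat gcd_1_nat, simp_all)
    ultimately show ?thesis by simp
  qed
  have "rat_gcd (of_nat p powi m) (of_nat p powi n) = of_nat p powi (min m n)" for m n
    using le[of m n] le[of n m] rat_gcd_commute[of "of_nat p powi m" "of_nat p powi n"]
    by (cases "m \<le> n") (simp_all add: min_def)
  thus "trop_power p (x \<oplus>\<^bsub>trop_min\<^esub> y) = trop_power p x \<oplus>\<^bsub>trop_gcd\<^esub> trop_power p y"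
    using assms(2,3)
    by (cases x; cases y) (simp_all add: trop_min_def trop_gcd_def trop_power_def rat_gcd_zero)
qed

end

theory Submission
  imports Defs "HOL-Library.Function_Algebras"
begin

text \<open>
  Write \<open>R\<close> for the ring of rational numbers whose denominator is prime to \<open>p\<close>, and put
  \<open>g v = f v / p ^ k v\<close>. The substitution turns the coboundary of \<open>f\<close> into the cochain with the
  value \<open>p ^ (k v + k w) * (g v + g w)\<close> on the edge \<open>{v, w}\<close>: the weights become a scaling of the
  edges and of the vertices, and in between stands the unweighted map \<open>B\<close> that sends \<open>g\<close> to the
  function \<open>{v, w} \<mapsto> g v + g w\<close>. The unweighted map is torsion free away from \<open>2\<close>, and \<open>2\<close> is
  invertible in \<open>R\<close>.

  After localization at \<open>p\<close> the torsion group is therefore the quotient \<open>L / I\<close> of two lattices of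
  rational vertex functions, taken modulo the kernel of \<open>B\<close>. Here \<open>L\<close> demands
  \<open>g v + g w \<in> p ^ - (k v + k w) R\<close> on the edges and \<open>I\<close> consists of the functions \<open>g\<close> with
  \<open>g v \<in> p ^ - k v R\<close> (\<open>card_primary_torsion\<close>). Both are compared with the lattice \<open>J\<close> of the
  functions \<open>g\<close> for which \<open>B g\<close> has values in \<open>R\<close>.

  The index of \<open>J\<close> in \<open>L\<close>. Call a set \<open>S\<close> of edges spanning if, over \<open>R\<close>, the value of \<open>B g\<close> on any
  edge is a combination of its values on \<open>S\<close>. Then restriction to \<open>S\<close> embeds \<open>L / J\<close> into the product
  of the groups \<open>p ^ - (k v + k w) R / R\<close> over \<open>{v, w} \<in> S\<close>, so that the index is at most \<open>p\<close> to the
  total weight of \<open>S\<close>. Kruskal's algorithm yields a spanning set for which the embedding is onto: if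
  \<open>e\<close> is not spanned by the lighter edges already chosen, then some function with values in
  \<open>{0, 1, -1}\<close> has vanishing edge sums on those and a nonzero one on \<open>e\<close>
  (\<open>not_spans_separating\<close>), so that the value on \<open>e\<close> can be prescribed freely. Hence the index is
  \<open>p\<close> to the minimal weight of a spanning set.

  The index of \<open>J\<close> in \<open>I\<close>. The kernel of \<open>B\<close> has one dimension for each bipartite component, given by
  the signs of its two sides. Let \<open>C\<close> meet every bipartite component. A function that vanishes on \<open>C\<close>
  and lies in \<open>J\<close> has values in \<open>R\<close>, so that \<open>I / J\<close> has at least \<open>p ^ k(V - C)\<close> elements. If \<open>C\<close>
  consists of a lightest vertex of each bipartite component, every function in \<open>I\<close> can be normalized
  to vanish on \<open>C\<close> (\<open>balanced_normal_form\<close>), which gives equality.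

  Thus the order of the torsion has exponent \<open>min k(S) + min k(C) - k(V)\<close>, where \<open>S\<close> runs through the
  spanning sets of edges and \<open>C\<close> through the sets of vertices that meet every bipartite component.
  Both families depend on the graph only, and the exponent is the value of a tropical rational
  function with a monomial as denominator.
\<close>

section \<open>Cosets of additive subgroups\<close>

definition add_subgroup :: "'b::ab_group_add set \<Rightarrow> bool" where
  "add_subgroup H \<longleftrightarrow> 0 \<in> H \<and> (\<forall>x\<in>H. \<forall>y\<in>H. x - y \<in> H)"

text \<open>
  A coset is kept as a set of elements of a type with subtraction. Indices are then cardinalities of
  images \<open>coset H ` G\<close>, and an index is computed by exchanging \<open>coset H\<close> for another function with the
  same fibres on \<open>G\<close>.
\<close>

definition coset :: "'b::ab_group_add set \<Rightarrow> 'b \<Rightarrow> 'b set" where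
  "coset H x = {y. y - x \<in> H}"

lemma add_subgroup_diff: "add_subgroup H \<Longrightarrow> x \<in> H \<Longrightarrow> y \<in> H \<Longrightarrow> x - y \<in> H"
  by (simp add: add_subgroup_def)

lemma add_subgroup_minus: "add_subgroup H \<Longrightarrow> x \<in> H \<Longrightarrow> - x \<in> H"
  by (metis add_subgroup_def diff_0)

lemma add_subgroup_add: "add_subgroup H \<Longrightarrow> x \<in> H \<Longrightarrow> y \<in> H \<Longrightarrow> x + y \<in> H"
  by (metis add_subgroup_diff add_subgroup_minus diff_minus_eq_add)

lemma coset_eq_iff:
  assumes "add_subgroup H"
  shows "coset H x = coset H y \<longleftrightarrow> x - y \<in> H"
proof
  assume "coset H x = coset H y"
  moreover have "x \<in> coset H x" using assms by (simp add: coset_def add_subgroup_def)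
  ultimately show "x - y \<in> H" by (simp add: coset_def)
next
  assume *: "x - y \<in> H"
  have "z - x \<in> H \<longleftrightarrow> z - y \<in> H" for z
    using add_subgroup_add[OF assms, of "z - x" "x - y"] add_subgroup_diff[OF assms, of "z - y" "x - y"] *
    by auto
  thus "coset H x = coset H y" by (simp add: coset_def)
qed

lemma card_image_eq_if_same_fibres:
  assumes "\<And>x y. x \<in> G \<Longrightarrow> y \<in> G \<Longrightarrow> a x = a y \<longleftrightarrow> b x = b y"
  shows "card (a ` G) = card (b ` G)"
proof (rule bij_betw_same_card)
  have r: "inv_into G a (a x) \<in> G" "a (inv_into G a (a x)) = a x" if "x \<in> G" for x
    using that by (auto simp: inv_into_into f_inv_into_f)
  hence b: "b (inv_into G a (a x)) = b x" if "x \<in> G" for x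
    using assms that by blast
  show "bij_betw (\<lambda>A. b (inv_into G a A)) (a ` G) (b ` G)"
    using b assms by (force simp: bij_betw_def inj_on_def image_image)
qed

text \<open>
  Multiplicativity of the index: after a choice of representatives for the cosets of \<open>K\<close>, a coset
  of \<open>H\<close> is given by the surrounding coset of \<open>K\<close> and the position inside it.
\<close>

lemma card_cosets_tower:
  assumes H: "add_subgroup H" and K: "add_subgroup K" and G: "add_subgroup G"
    and sub: "H \<subseteq> K" "K \<subseteq> G"
  shows "card (coset H ` G) = card (coset K ` G) * card (coset H ` K)"
proof -
  define rep where "rep A = inv_into G (coset K) A" for A
  have rep: "rep (coset K x) \<in> G" "coset K (rep (coset K x)) = coset K x" if "x \<in> G" for x
    using that by (auto simp: rep_def inv_into_into f_inv_into_f)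
  define key where "key x = (coset K x, coset H (x - rep (coset K x)))" for x
  have d: "x - rep (coset K x) \<in> K" if "x \<in> G" for x
    using rep(2)[OF that] coset_eq_iff[OF K] by metis
  have "card (coset H ` G) = card (key ` G)"
  proof (rule card_image_eq_if_same_fibres)
    fix x y assume "x \<in> G" "y \<in> G"
    show "coset H x = coset H y \<longleftrightarrow> key x = key y"
    proof
      assume "coset H x = coset H y"
      moreover from this have "coset K x = coset K y"
        using sub H K by (auto simp: coset_eq_iff)
      ultimately show "key x = key y"
        using H by (simp add: key_def coset_eq_iff)
    next
      assume "key x = key y"
      thus "coset H x = coset H y"
        using H by (auto simp: key_def coset_eq_iff)
    qed
  qed
  also have "key ` G = coset K ` G \<times> coset H ` K"
  proof (intro equalityI subsetI)
    fix z assume "z \<in> coset K ` G \<times> coset H ` K"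
    then obtain x y where x: "x \<in> G" and y: "y \<in> K" and z: "z = (coset K x, coset H y)" by auto
    define u where "u = rep (coset K x) + y"
    have u: "u \<in> G" unfolding u_def using rep(1)[OF x] y sub G by (intro add_subgroup_add) auto
    have "coset K u = coset K (rep (coset K x))"
      using y K by (simp add: coset_eq_iff u_def)
    hence "coset K u = coset K x" using rep(2)[OF x] by simp
    hence "key u = z" by (simp add: key_def z) (simp add: u_def)
    thus "z \<in> key ` G" using u by blast
  qed (use d in \<open>auto simp: key_def\<close>)
  finally show ?thesis by (simp add: card_cartesian_product)
qed

section \<open>Parity of walks and spanning edge sets\<close>

text \<open>
  The Boolean tells whether the length of the walk is odd. Modulo the edge sums on \<open>S\<close>, a function
  takes opposite values at the two ends of an odd walk and equal values at the ends of an even one.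
\<close>

inductive parity_walk :: "'a set set \<Rightarrow> 'a \<Rightarrow> bool \<Rightarrow> 'a \<Rightarrow> bool" for S where
  refl: "parity_walk S v False v"
| step: "parity_walk S v b w \<Longrightarrow> {w, u} \<in> S \<Longrightarrow> parity_walk S v (\<not> b) u"

lemma parity_walk_edge: "{v, w} \<in> S \<Longrightarrow> parity_walk S v True w"
  using parity_walk.step[OF parity_walk.refl] by fastforce

lemma parity_walk_trans:
  assumes "parity_walk S w c u" "parity_walk S v b w"
  shows "parity_walk S v (b \<noteq> c) u"
  using assms
proof (induction rule: parity_walk.induct)
  case (step w c x y)
  have "parity_walk S v (\<not> (b \<noteq> c)) y" by (rule parity_walk.step[OF step.IH[OF step.prems] step.hyps(2)])
  thus ?case by (cases b; cases c) auto
qed simp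

lemma parity_walk_sym: "parity_walk S v b w \<Longrightarrow> parity_walk S w b v"
proof (induction rule: parity_walk.induct)
  case (step v b w u)
  have "parity_walk S u True w" using step.hyps(2) by (intro parity_walk_edge) (simp add: insert_commute)
  from parity_walk_trans[OF step.IH this] show ?case by simp
qed (rule parity_walk.refl)

text \<open>
  An odd closed walk at \<open>v\<close> forces \<open>2 g v\<close> to be a combination of edge sums. The vertices that admit
  none are those of the bipartite components.
\<close>

definition frustrated :: "'a set set \<Rightarrow> 'a \<Rightarrow> bool" where
  "frustrated S v \<longleftrightarrow> parity_walk S v True v"

lemma not_frustrated_parity_unique:
  assumes "\<not> frustrated S v" "parity_walk S v b w" "parity_walk S v c w"
  shows "b = c"
  using parity_walk_trans[OF parity_walk_sym[OF assms(2)] assms(3)] assms(1)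
  by (cases b; cases c) (auto simp: frustrated_def)

lemma frustrated_walk:
  assumes "parity_walk S v b w"
  shows "frustrated S v \<longleftrightarrow> frustrated S w"
proof -
  have "frustrated S y" if "frustrated S x" "parity_walk S x b y" for x y
  proof -
    have "parity_walk S y ((b \<noteq> True) \<noteq> b) y"
      using that parity_walk_trans[OF that(2) parity_walk_trans[OF _ parity_walk_sym[OF that(2)]]]
      unfolding frustrated_def by blast
    thus ?thesis by (cases b) (auto simp: frustrated_def)
  qed
  thus ?thesis using assms parity_walk_sym[OF assms] by blast
qed

text \<open>
  On the component of a vertex \<open>v\<close> without odd closed walk this is the sign function of the
  bipartition, normalized to \<open>1\<close> at \<open>v\<close> and extended by \<open>0\<close>. It spans the part of the kernel of the
  edge sum map that is supported on the component.
\<close>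

definition walk_sign :: "'a set set \<Rightarrow> 'a \<Rightarrow> 'a \<Rightarrow> rat" where
  "walk_sign S v u = (if parity_walk S v False u then 1 else if parity_walk S v True u then -1 else 0)"

lemma walk_sign_edge:
  assumes "\<not> frustrated S v" "s \<in> S" "card s = 2"
  shows "sum (walk_sign S v) s = 0"
proof -
  obtain a b where s: "s = {a, b}" "a \<noteq> b" using assms(3) by (auto simp: card_2_iff)
  have e: "parity_walk S v (\<not> c) y" if "parity_walk S v c x" "{x, y} = s" for c x y
    using parity_walk.step[OF that(1)] that(2) assms(2) by blast
  have "parity_walk S v c a \<longleftrightarrow> parity_walk S v (\<not> c) b" for c
    using e[of c a b] e[of "\<not> c" b a] s by auto
  from this[of True] this[of False] not_frustrated_parity_unique[OF assms(1), of True a False]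
  show ?thesis using s by (auto simp: walk_sign_def)
qed

text \<open>
  Along a walk the edge sums telescope with alternating signs.
\<close>

lemma walk_value:
  assumes "parity_walk S v b w" and M: "add_subgroup M"
    and g: "\<And>s. s \<in> S \<Longrightarrow> sum g s \<in> M" and S: "\<And>s. s \<in> S \<Longrightarrow> card s = 2"
  shows "(if b then g v + g w else g v - g w) \<in> M"
  using assms(1)
proof (induction rule: parity_walk.induct)
  case (refl v)
  show ?case using M by (simp add: add_subgroup_def)
next
  case (step v b w u)
  have "w \<noteq> u" using S[OF step.hyps(2)] by auto
  hence "g w + g u \<in> M" using g[OF step.hyps(2)] by simp
  with step.IH show ?case
    using add_subgroup_diff[OF M, of "g v + g w" "g w + g u"]
      add_subgroup_add[OF M, of "g v - g w" "g w + g u"]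
    by (cases b) auto
qed

text \<open>
  Combinatorial form of the condition that, with \<open>2\<close> invertible, the edge sum on \<open>e\<close> is a
  combination of the edge sums on \<open>S\<close>: an odd walk between the ends does it directly, and odd closed
  walks at both ends give the values at the ends separately. The condition does not mention a prime,
  which makes the final rational function independent of \<open>p\<close>.
\<close>

definition spans :: "'a set set \<Rightarrow> 'a set \<Rightarrow> bool" where
  "spans S e \<longleftrightarrow> (\<forall>v w. e = {v, w} \<longrightarrow> parity_walk S v True w \<or> frustrated S v \<and> frustrated S w)"

lemma spans_value:
  fixes g :: "'a \<Rightarrow> rat"
  assumes e: "spans S e" "card e = 2" and M: "add_subgroup M" "\<And>x. 2 * x \<in> M \<Longrightarrow> x \<in> M"
    and g: "\<And>s. s \<in> S \<Longrightarrow> sum g s \<in> M" and S: "\<And>s. s \<in> S \<Longrightarrow> card s = 2"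
  shows "sum g e \<in> M"
proof -
  obtain v w where vw: "e = {v, w}" "v \<noteq> w" using e(2) by (auto simp: card_2_iff)
  note wv = walk_value[where S = S and M = M and g = g, OF _ M(1) g S]
  from e(1) vw consider "parity_walk S v True w" | "frustrated S v" "frustrated S w"
    by (auto simp: spans_def)
  thus ?thesis
  proof cases
    case 1
    thus ?thesis using wv[OF 1] vw by simp
  next
    case 2
    hence "2 * g v \<in> M" "2 * g w \<in> M" using wv[of v True v] wv[of w True w]
      by (simp_all add: frustrated_def)
    thus ?thesis using M vw by (simp add: add_subgroup_add)
  qed
qed

lemma spans_member:
  assumes "e \<in> S" shows "spans S e"
  using assms parity_walk_edge[of _ _ S] by (auto simp: spans_def)

lemma parity_walk_mono:
  assumes "parity_walk S v b w" "S \<subseteq> S'"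
  shows "parity_walk S' v b w"
  using assms(1)
proof (induction rule: parity_walk.induct)
  case (step v b w u)
  thus ?case using assms(2) by (blast intro: parity_walk.step)
qed (rule parity_walk.refl)

lemma spans_mono:
  assumes "spans S e" "S \<subseteq> S'"
  shows "spans S' e"
  using assms parity_walk_mono unfolding spans_def frustrated_def by metis

text \<open>
  Converse of \<open>spans_value\<close>: one of the two ends, say \<open>v\<close>, has no odd closed walk, and the sign
  function based at \<open>v\<close> has the value \<open>0\<close> or \<open>1\<close>, but not \<open>-1\<close>, at the other end.
\<close>

lemma not_spans_separating:
  assumes "\<not> spans S e" "card e = 2" and S: "\<And>s. s \<in> S \<Longrightarrow> card s = 2"
  obtains \<phi> :: "'a \<Rightarrow> rat" where "\<And>s. s \<in> S \<Longrightarrow> sum \<phi> s = 0" "sum \<phi> e \<noteq> 0"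
proof -
  obtain v w where vw: "e = {v, w}" "\<not> parity_walk S v True w" "\<not> frustrated S v"
    using assms(1) parity_walk_sym unfolding spans_def by (metis insert_commute)
  have ne: "v \<noteq> w" using assms(2) vw by auto
  have "sum (walk_sign S v) e \<noteq> 0"
    using vw ne parity_walk.refl[of S v] by (simp add: walk_sign_def)
  thus ?thesis using that walk_sign_edge[OF vw(3)] S by blast
qed

text \<open>
  Kruskal's algorithm. The edges enter in the order of increasing cost and an edge is selected
  when the edges selected before do not span it. Every edge is thus spanned by selected edges that are
  not more expensive, while the edge sums on the selected edges can be prescribed independently.
\<close>

lemma greedy_basis:
  fixes c :: "'a set \<Rightarrow> nat"
  assumes "finite E" and E: "\<And>e. e \<in> E \<Longrightarrow> card e = 2"
  obtains S where "S \<subseteq> E" "\<And>e. e \<in> E \<Longrightarrow> spans {s \<in> S. c s \<le> c e} e"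
    "\<And>y :: 'a set \<Rightarrow> rat. \<exists>g. \<forall>s\<in>S. sum g s = y s"
proof -
  have "\<exists>S\<subseteq>E. (\<forall>e\<in>E. spans {s \<in> S. c s \<le> c e} e) \<and>
      (\<forall>y :: 'a set \<Rightarrow> rat. \<exists>g. \<forall>s\<in>S. sum g s = y s)"
    using assms
  proof (induction E rule: finite_ranking_induct[where f = c])
    case (insert x E)
    then obtain S where S: "S \<subseteq> E" "\<And>e. e \<in> E \<Longrightarrow> spans {s \<in> S. c s \<le> c e} e"
      "\<And>y :: 'a set \<Rightarrow> rat. \<exists>g. \<forall>s\<in>S. sum g s = y s" by auto
    show ?case
    proof (cases "spans S x")
      case True
      moreover have "{s \<in> S. c s \<le> c x} = S" using S(1) insert.hyps(2) by auto
      ultimately show ?thesis using S by (intro exI[of _ S]) auto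
    next
      case False
      obtain \<phi> :: "'a \<Rightarrow> rat" where \<phi>: "\<And>s. s \<in> S \<Longrightarrow> sum \<phi> s = 0" "sum \<phi> x \<noteq> 0"
        by (rule not_spans_separating[OF False]) (use insert.prems S(1) in auto)
      have "\<exists>g. \<forall>s\<in>insert x S. sum g s = y s" for y :: "'a set \<Rightarrow> rat"
      proof -
        obtain g where g: "\<And>s. s \<in> S \<Longrightarrow> sum g s = y s" using S(3)[of y] by blast
        \<comment> \<open>adding a multiple of \<open>\<phi>\<close> corrects the value on \<open>x\<close> and preserves those on \<open>S\<close>\<close>
        define t where "t = (y x - sum g x) / sum \<phi> x"
        have "sum (\<lambda>v. g v + t * \<phi> v) s = sum g s + t * sum \<phi> s" for s
          by (simp add: sum.distrib sum_distrib_left)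
        thus ?thesis using g \<phi>
          by (intro exI[of _ "\<lambda>v. g v + t * \<phi> v"]) (simp add: t_def)
      qed
      moreover have "spans {s \<in> insert x S. c s \<le> c e} e" if "e \<in> insert x E" for e
        using that
      proof
        assume "e = x" thus ?thesis by (intro spans_member) simp
      next
        assume "e \<in> E"
        from S(2)[OF this] show ?thesis by (rule spans_mono) auto
      qed
      ultimately show ?thesis using S(1) by (intro exI[of _ "insert x S"]) auto
    qed
  qed auto
  thus ?thesis using that by blast
qed

section \<open>Rational numbers integral at a prime\<close>

definition p_integral :: "nat \<Rightarrow> rat set" where
  "p_integral p = {x. \<exists>b::int. coprime b (int p) \<and> of_int b * x \<in> \<int>}"

text \<open>
  The fractional ideal \<open>p ^ - n R\<close>, where \<open>R\<close> is the localization \<open>p_integral p\<close> of the integers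
  at \<open>p\<close>.
\<close>

definition p_fractional :: "nat \<Rightarrow> nat \<Rightarrow> rat set" where
  "p_fractional p n = {x. of_nat p ^ n * x \<in> p_integral p}"

lemma p_integralI: "coprime b (int p) \<Longrightarrow> of_int b * x \<in> \<int> \<Longrightarrow> x \<in> p_integral p"
  by (auto simp: p_integral_def)

lemma of_int_in_p_integral: "of_int a \<in> p_integral p"
  by (rule p_integralI[of 1]) auto

lemma p_integral_common_denominator:
  assumes "finite A" "\<And>a. a \<in> A \<Longrightarrow> f a \<in> p_integral p"
  obtains b :: int where "coprime b (int p)" "\<And>a. a \<in> A \<Longrightarrow> of_int b * f a \<in> \<int>"
proof -
  have "\<exists>b::int. coprime b (int p) \<and> (\<forall>a\<in>A. of_int b * f a \<in> \<int>)"
    using assms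
  proof (induction A rule: finite_induct)
    case (insert x A)
    then obtain b :: int where b: "coprime b (int p)" "\<And>a. a \<in> A \<Longrightarrow> of_int b * f a \<in> \<int>" by auto
    obtain c :: int where c: "coprime c (int p)" "of_int c * f x \<in> \<int>"
      using insert.prems[of x] by (auto simp: p_integral_def)
    have "of_int (b * c) * f a \<in> \<int>" if "a \<in> insert x A" for a
    proof (cases "a = x")
      case True
      have "of_int (b * c) * f a = of_int b * (of_int c * f x)" by (simp add: True)
      also have "\<dots> \<in> \<int>" by (intro Ints_mult c) simp
      finally show ?thesis .
    next
      case False
      have "of_int (b * c) * f a = of_int c * (of_int b * f a)" by simp
      also have "\<dots> \<in> \<int>" using False that by (intro Ints_mult b) auto
      finally show ?thesis .
    qed
    thus ?case using b c by (intro exI[of _ "b * c"]) simp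
  qed (auto intro: exI[of _ 1])
  thus ?thesis using that by blast
qed

lemma add_subgroup_p_integral: "add_subgroup (p_integral p)"
proof -
  have "x - y \<in> p_integral p" if x: "x \<in> p_integral p" and y: "y \<in> p_integral p" for x y
  proof -
    obtain b where b: "coprime b (int p)" "\<And>a. a \<in> {x, y} \<Longrightarrow> of_int b * a \<in> \<int>"
      by (rule p_integral_common_denominator[of "{x, y}" "\<lambda>a. a" p]) (use x y in auto)
    thus ?thesis by (intro p_integralI[of b]) (auto simp: right_diff_distrib)
  qed
  thus ?thesis using of_int_in_p_integral[of 0] by (simp add: add_subgroup_def)
qed

lemma p_integral_mult_int:
  assumes "x \<in> p_integral p" shows "of_int a * x \<in> p_integral p"
proof -
  obtain b where b: "coprime b (int p)" "of_int b * x \<in> \<int>" using assms by (auto simp: p_integral_def)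
  have "of_int b * (of_int a * x) = of_int a * (of_int b * x)" by simp
  also have "\<dots> \<in> \<int>" by (intro Ints_mult b) simp
  finally show ?thesis using b by (intro p_integralI)
qed

lemma p_integral_cancel:
  assumes "coprime a (int p)" "of_int a * x \<in> p_integral p"
  shows "x \<in> p_integral p"
proof -
  obtain b where b: "coprime b (int p)" "of_int b * (of_int a * x) \<in> \<int>"
    using assms(2) by (auto simp: p_integral_def)
  thus ?thesis using assms(1) by (intro p_integralI[of "b * a"]) (simp_all add: mult.assoc)
qed

lemma add_subgroup_p_fractional: "add_subgroup (p_fractional p n)"
  using add_subgroup_p_integral[of p]
  by (auto simp: add_subgroup_def p_fractional_def right_diff_distrib)

lemma p_fractional_cancel:
  assumes "coprime a (int p)" "of_int a * x \<in> p_fractional p n"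
  shows "x \<in> p_fractional p n"
  using assms(2) p_integral_cancel[OF assms(1), of "of_nat p ^ n * x"]
  by (simp add: p_fractional_def mult.left_commute)

lemma p_fractional_0: "p_fractional p 0 = p_integral p"
  by (simp add: p_fractional_def)

lemma p_fractional_mono:
  assumes "m \<le> n"
  shows "p_fractional p m \<subseteq> p_fractional p n"
proof
  fix x assume "x \<in> p_fractional p m"
  hence "of_int (int (p ^ (n - m))) * (of_nat p ^ m * x) \<in> p_integral p"
    unfolding p_fractional_def by (intro p_integral_mult_int) simp
  moreover have "of_nat p ^ n = (of_int (int (p ^ (n - m))) * of_nat p ^ m :: rat)"
    using assms by (simp add: power_add[symmetric])
  ultimately show "x \<in> p_fractional p n"
    unfolding p_fractional_def mem_Collect_eq by (simp only: mult.assoc)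
qed

text \<open>
  The fractions \<open>j / p ^ n\<close> with \<open>j < p ^ n\<close> represent the cosets: a denominator prime to \<open>p\<close> can be
  inverted modulo \<open>p ^ n\<close>.
\<close>

lemma card_p_fractional_mod_p_integral:
  assumes "p > 0"
  shows "card (coset (p_integral p) ` p_fractional p n) = p ^ n"
proof -
  define q where "q = p ^ n"
  have q: "q > 0" using assms by (simp add: q_def)
  define d where "d j = coset (p_integral p) (of_nat j / of_nat q)" for j :: nat
  note iff = coset_eq_iff[OF add_subgroup_p_integral]
  have "coset (p_integral p) ` p_fractional p n = d ` {..<q}"
  proof (intro equalityI subsetI; elim imageE; hypsubst)
    fix x assume "x \<in> p_fractional p n"
    then obtain b a where b: "coprime b (int p)" and a: "of_int b * (of_nat q * x) = of_int a"
      by (auto simp: p_fractional_def p_integral_def q_def elim: Ints_cases)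
    have "coprime b (int q)" using b by (simp add: q_def)
    then obtain c u where c: "c * b + u * int q = 1"
      using bezout_int[of b "int q"] by auto
    define j where "j = nat ((c * a) mod int q)"
    have j: "int j = (c * a) mod int q" "j < q" using q
      by (simp_all add: j_def nat_less_iff)
    define t where "t = a * u + b * ((c * a) div int q)"
    have "a = a * (c * b + u * int q)" using c by simp
    hence "a - b * int j = a * u * int q + b * (c * a - int j)"
      by (simp add: algebra_simps)
    hence t: "a - b * int j = int q * t"
      unfolding j minus_mod_eq_mult_div by (simp add: t_def algebra_simps)
    have "of_int b * (x - of_nat j / of_nat q) = (of_int (a - b * int j) :: rat) / of_nat q"
      using a q by (simp add: field_simps)
    also have "\<dots> = of_int t" unfolding t using q by simp
    finally have "x - of_nat j / of_nat q \<in> p_integral p" using b by (intro p_integralI) auto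
    hence "coset (p_integral p) x = d j" by (simp add: iff d_def)
    thus "coset (p_integral p) x \<in> d ` {..<q}" using j by blast
  next
    fix j
    have "of_nat j / of_nat q \<in> p_fractional p n"
      using q of_int_in_p_integral[of "int j" p] by (simp add: p_fractional_def q_def)
    thus "d j \<in> coset (p_integral p) ` p_fractional p n" by (simp add: d_def)
  qed
  moreover have "inj_on d {..<q}"
  proof (rule inj_onI)
    fix i j assume ij: "i \<in> {..<q}" "j \<in> {..<q}" "d i = d j"
    hence "of_nat i / of_nat q - of_nat j / of_nat q \<in> p_integral p" by (simp add: d_def iff)
    then obtain b a where b: "coprime b (int p)"
      and a: "of_int b * (of_nat i / of_nat q - of_nat j / of_nat q) = (of_int a :: rat)"
      by (auto simp: p_integral_def elim: Ints_cases)
    have "of_int (b * (int i - int j)) = (of_int (a * int q) :: rat)"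
      using a q by (simp add: field_simps)
    hence "b * (int i - int j) = a * int q" by (simp only: of_int_eq_iff)
    moreover have "coprime (int q) b" using b by (simp add: q_def coprime_commute)
    ultimately have dvd: "int q dvd int i - int j"
      by (metis coprime_dvd_mult_right_iff dvd_triv_right)
    have "\<bar>int i - int j\<bar> < int q" using ij by auto
    hence "int i - int j = 0" using dvd_imp_le_int[OF _ dvd] by fastforce
    thus "i = j" by simp
  qed
  ultimately show ?thesis by (simp add: card_image q_def)
qed

section \<open>Three lattices of rational vertex functions\<close>

definition spanning :: "'a set set \<Rightarrow> 'a set set \<Rightarrow> bool" where
  "spanning E S \<longleftrightarrow> S \<subseteq> E \<and> (\<forall>e\<in>E. spans S e)"

text \<open>
  By \<open>frustrated_walk\<close> the condition concerns components: those with a vertex that is not frustrated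
  are the bipartite ones.
\<close>

definition meets_balanced :: "'a set \<Rightarrow> 'a set set \<Rightarrow> 'a set \<Rightarrow> bool" where
  "meets_balanced V E C \<longleftrightarrow>
    C \<subseteq> V \<and> (\<forall>v\<in>V. \<not> frustrated E v \<longrightarrow> (\<exists>c\<in>C. \<exists>b. parity_walk E v b c))"

locale prime_weighted_graph =
  fixes V :: "'a set" and E :: "'a set set" and k :: "'a \<Rightarrow> nat" and p :: nat
  assumes graph: "finite_simple_graph V E" and prime: "prime p" and odd: "odd p"
begin

abbreviation R where "R \<equiv> p_integral p"

text \<open>
  A function \<open>g\<close> stands for the rational vertex function \<open>f v = p ^ k v * g v\<close>, whose weighted
  coboundary is \<open>p ^ (k v + k w) * (g v + g w)\<close> on \<open>{v, w}\<close>. The first lattice consists of the \<open>g\<close>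
  with an \<open>R\<close>-valued coboundary, the second of those whose coboundary is also the coboundary of an
  \<open>R\<close>-valued function. The third is the common value of both lattices for the weights \<open>k = 0\<close>; it
  serves as the reference for the indices of the other two. All of them contain the kernel of the edge
  sum map, so that a quotient of two of them is a quotient of lattices of cochains.
\<close>

definition cocycle_lattice :: "('a \<Rightarrow> rat) set" where
  "cocycle_lattice = {g. \<forall>e\<in>E. sum g e \<in> p_fractional p (sum k e)}"
definition coboundary_lattice :: "('a \<Rightarrow> rat) set" where
  "coboundary_lattice = {g. \<exists>h. (\<forall>v\<in>V. h v \<in> p_fractional p (k v)) \<and> (\<forall>e\<in>E. sum g e = sum h e)}"
definition unweighted_lattice :: "('a \<Rightarrow> rat) set" where
  "unweighted_lattice = {g. \<forall>e\<in>E. sum g e \<in> R}"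

lemma edgeD: "e \<in> E \<Longrightarrow> e \<subseteq> V" "e \<in> E \<Longrightarrow> card e = 2" and finite_V: "finite V" and finite_E: "finite E"
proof -
  show "e \<in> E \<Longrightarrow> e \<subseteq> V" "e \<in> E \<Longrightarrow> card e = 2" "finite V"
    using graph by (auto simp: finite_simple_graph_def)
  have "E \<subseteq> Pow V" using graph by (auto simp: finite_simple_graph_def)
  thus "finite E" using \<open>finite V\<close> finite_subset by blast
qed

lemma edgeE:
  assumes "e \<in> E"
  obtains v w where "e = {v, w}" "v \<noteq> w" "v \<in> V" "w \<in> V"
  using edgeD[OF assms] by (auto simp: card_2_iff)

lemma p_gt_0: "p > 0" and p_gt_1: "p > 1" using prime prime_gt_0_nat prime_gt_1_nat by auto

lemma coprime_2: "coprime 2 (int p)"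
  using odd by simp

lemma halve: "2 * x \<in> p_fractional p n \<Longrightarrow> x \<in> p_fractional p n"
  using p_fractional_cancel[OF coprime_2, of x n] by simp

lemma halve_R: "2 * x \<in> R \<Longrightarrow> x \<in> R"
  using halve[of x 0] by (simp add: p_fractional_0)

lemma sum_diff_fun: "sum (g - h) e = sum g e - sum h e" for g h :: "'a \<Rightarrow> rat"
  by (simp add: sum_subtractf)

lemma add_subgroup_cocycle_lattice: "add_subgroup cocycle_lattice"
  using add_subgroup_p_fractional[of p]
  by (auto simp: add_subgroup_def cocycle_lattice_def sum_diff_fun sum_subtractf)

lemma add_subgroup_unweighted_lattice: "add_subgroup unweighted_lattice"
  using add_subgroup_p_integral[of p]
  by (auto simp: add_subgroup_def unweighted_lattice_def sum_diff_fun sum_subtractf)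

lemma coset_unweighted_eq_iff:
  "coset unweighted_lattice g = coset unweighted_lattice h \<longleftrightarrow> (\<forall>e\<in>E. sum g e - sum h e \<in> R)"
proof -
  have "coset unweighted_lattice g = coset unweighted_lattice h \<longleftrightarrow> g - h \<in> unweighted_lattice"
    by (rule coset_eq_iff[OF add_subgroup_unweighted_lattice])
  thus ?thesis by (simp only: unweighted_lattice_def mem_Collect_eq sum_diff_fun)
qed

lemma add_subgroup_coboundary_lattice: "add_subgroup coboundary_lattice"
  unfolding add_subgroup_def
proof (intro conjI ballI)
  show "0 \<in> coboundary_lattice" using add_subgroup_p_fractional[of p]
    by (auto simp: coboundary_lattice_def add_subgroup_def intro!: exI[of _ 0])
  fix g g' assume "g \<in> coboundary_lattice" "g' \<in> coboundary_lattice"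
  then obtain h h' where "\<forall>v\<in>V. h v \<in> p_fractional p (k v)" "\<forall>e\<in>E. sum g e = sum h e"
    "\<forall>v\<in>V. h' v \<in> p_fractional p (k v)" "\<forall>e\<in>E. sum g' e = sum h' e" by (auto simp: coboundary_lattice_def)
  thus "g - g' \<in> coboundary_lattice" unfolding coboundary_lattice_def
    using add_subgroup_diff[OF add_subgroup_p_fractional[of p]]
    by (intro CollectI exI[of _ "h - h'"]) (simp add: sum_subtractf)
qed

lemma coboundary_subset_cocycle: "coboundary_lattice \<subseteq> cocycle_lattice"
proof
  fix g assume "g \<in> coboundary_lattice"
  then obtain h where h: "\<And>v. v \<in> V \<Longrightarrow> h v \<in> p_fractional p (k v)" "\<And>e. e \<in> E \<Longrightarrow> sum g e = sum h e"
    by (auto simp: coboundary_lattice_def)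
  show "g \<in> cocycle_lattice" unfolding cocycle_lattice_def
  proof (intro CollectI ballI)
    fix e assume e: "e \<in> E"
    then obtain v w where vw: "e = {v, w}" "v \<noteq> w" "v \<in> V" "w \<in> V" by (rule edgeE)
    have "h v + h w \<in> p_fractional p (sum k e)"
      using h(1)[OF vw(3)] h(1)[OF vw(4)] p_fractional_mono[of "k v" "sum k e" p]
        p_fractional_mono[of "k w" "sum k e" p] vw
      by (intro add_subgroup_add[OF add_subgroup_p_fractional]) auto
    thus "sum g e \<in> p_fractional p (sum k e)" using h(2)[OF e] vw by simp
  qed
qed

abbreviation edge_classes where
  "edge_classes S g \<equiv> restrict (\<lambda>e. coset R (sum g e)) S"

text \<open>
  Edge sums on a spanning set that are congruent modulo \<open>R\<close> are congruent on all edges, because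
  \<open>2\<close> is invertible in \<open>R\<close>.
\<close>

lemma spanning_card_edge_key:
  assumes "spanning E S"
  shows "card (coset unweighted_lattice ` cocycle_lattice) =
    card (edge_classes S ` cocycle_lattice)"
proof (rule card_image_eq_if_same_fibres)
  fix g h
  have S: "S \<subseteq> E" "\<And>s. s \<in> S \<Longrightarrow> card s = 2" using assms edgeD by (auto simp: spanning_def)
  have "(\<forall>e\<in>E. sum (g - h) e \<in> R) \<longleftrightarrow> (\<forall>e\<in>S. sum (g - h) e \<in> R)"
  proof
    assume *: "\<forall>e\<in>S. sum (g - h) e \<in> R"
    show "\<forall>e\<in>E. sum (g - h) e \<in> R"
    proof
      fix e assume "e \<in> E"
      show "sum (g - h) e \<in> R"
        by (rule spans_value[of S, OF _ _ add_subgroup_p_integral halve_R])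
          (use * assms edgeD \<open>e \<in> E\<close> S in \<open>auto simp: spanning_def\<close>)
    qed
  qed (use S in auto)
  moreover have "coset unweighted_lattice g = coset unweighted_lattice h \<longleftrightarrow> (\<forall>e\<in>E. sum (g - h) e \<in> R)"
    by (simp only: coset_unweighted_eq_iff sum_diff_fun)
  moreover have "edge_classes S g = edge_classes S h \<longleftrightarrow>
      (\<forall>e\<in>S. sum (g - h) e \<in> R)"
    by (auto simp: restrict_def fun_eq_iff coset_eq_iff[OF add_subgroup_p_integral] sum_subtractf)
  ultimately show "coset unweighted_lattice g = coset unweighted_lattice h \<longleftrightarrow>
      edge_classes S g = edge_classes S h" by simp
qed

lemma card_PiE_fractional:
  assumes "finite A"
  shows "card (PiE A (\<lambda>a. coset R ` p_fractional p (w a))) = p ^ sum w A"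
    "finite (PiE A (\<lambda>a. coset R ` p_fractional p (w a)))"
proof -
  have c: "card (coset R ` p_fractional p n) = p ^ n" for n
    by (rule card_p_fractional_mod_p_integral[OF p_gt_0])
  thus "card (PiE A (\<lambda>a. coset R ` p_fractional p (w a))) = p ^ sum w A"
    using assms by (simp add: card_PiE power_sum)
  have "finite (coset R ` p_fractional p n)" for n
    using c[of n] p_gt_0 by (intro card_ge_0_finite) simp
  thus "finite (PiE A (\<lambda>a. coset R ` p_fractional p (w a)))" using assms by (intro finite_PiE)
qed

lemma index_unweighted_in_cocycle_le:
  assumes "spanning E S"
  shows "card (coset unweighted_lattice ` cocycle_lattice) \<le> p ^ (\<Sum>e\<in>S. sum k e)"
proof -
  have "finite S" using assms finite_E finite_subset by (auto simp: spanning_def)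
  moreover have "edge_classes S ` cocycle_lattice
      \<subseteq> PiE S (\<lambda>e. coset R ` p_fractional p (sum k e))"
    using assms by (auto simp: cocycle_lattice_def spanning_def)
  ultimately show ?thesis unfolding spanning_card_edge_key[OF assms]
    using card_PiE_fractional[of S "sum k"] by (metis card_mono)
qed

text \<open>
  For the greedy basis the restriction to \<open>S\<close> is onto. Its selected edges of cost at most
  \<open>k v + k w\<close> span \<open>{v, w}\<close>, hence a function with edge sums of the allowed denominators on \<open>S\<close> has
  allowed denominators on all edges.
\<close>

lemma index_unweighted_in_cocycle_attained:
  obtains S where "spanning E S" "card (coset unweighted_lattice ` cocycle_lattice) = p ^ (\<Sum>e\<in>S. sum k e)"
proof -
  obtain S where S: "S \<subseteq> E" "\<And>e. e \<in> E \<Longrightarrow> spans {s \<in> S. sum k s \<le> sum k e} e"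
    "\<And>y :: 'a set \<Rightarrow> rat. \<exists>g. \<forall>s\<in>S. sum g s = y s"
    using greedy_basis[OF finite_E edgeD(2), of "sum k"] by metis
  have sp: "spanning E S" using S(1) spans_mono[OF S(2)] by (auto simp: spanning_def)
  have "PiE S (\<lambda>e. coset R ` p_fractional p (sum k e))
      \<subseteq> edge_classes S ` cocycle_lattice"
  proof
    fix Y assume Y: "Y \<in> PiE S (\<lambda>e. coset R ` p_fractional p (sum k e))"
    hence "\<forall>e\<in>S. \<exists>y. y \<in> p_fractional p (sum k e) \<and> Y e = coset R y" by (auto simp: PiE_iff)
    then obtain y where y: "\<And>e. e \<in> S \<Longrightarrow> y e \<in> p_fractional p (sum k e)"
      "\<And>e. e \<in> S \<Longrightarrow> Y e = coset R (y e)"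
      by metis
    obtain g where g: "\<And>s. s \<in> S \<Longrightarrow> sum g s = y s" using S(3)[of y] by blast
    have "g \<in> cocycle_lattice" unfolding cocycle_lattice_def
    proof (intro CollectI ballI)
      fix e assume e: "e \<in> E"
      show "sum g e \<in> p_fractional p (sum k e)"
      proof (rule spans_value[OF S(2)[OF e] edgeD(2)[OF e] add_subgroup_p_fractional halve])
        fix s assume s: "s \<in> {s \<in> S. sum k s \<le> sum k e}"
        thus "sum g s \<in> p_fractional p (sum k e)"
          using g y p_fractional_mono[of "sum k s" "sum k e" p] by auto
        show "card s = 2" using s S(1) edgeD by auto
      qed
    qed
    moreover have "Y = edge_classes S g"
      by (rule PiE_ext[OF Y]) (use g y in auto)
    ultimately show "Y \<in> edge_classes S ` cocycle_lattice" by blast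
  qed
  moreover have "edge_classes S ` cocycle_lattice
      \<subseteq> PiE S (\<lambda>e. coset R ` p_fractional p (sum k e))"
    using S(1) by (auto simp: cocycle_lattice_def)
  ultimately have "card (coset unweighted_lattice ` cocycle_lattice) = p ^ (\<Sum>e\<in>S. sum k e)"
    unfolding spanning_card_edge_key[OF sp]
    using card_PiE_fractional(1)[of S "sum k"] finite_subset[OF S(1) finite_E] by (metis subset_antisym)
  thus ?thesis using that sp by blast
qed

text \<open>
  Modulo the reference lattice, functions that vanish on \<open>C\<close> are determined by their values modulo
  \<open>R\<close>: a difference with edge sums in \<open>R\<close> has values in \<open>R\<close> at the vertices with an odd closed walk,
  and at the others its value is up to sign congruent to its value \<open>0\<close> at a vertex of \<open>C\<close>. At each
  vertex outside \<open>C\<close> the value is arbitrary.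
\<close>

lemma meets_balanced_card:
  assumes C: "meets_balanced V E C"
  defines "N \<equiv> {h. (\<forall>v\<in>V. h v \<in> p_fractional p (k v)) \<and> (\<forall>c\<in>C. h c = 0)}"
  shows "card (coset unweighted_lattice ` N) = p ^ sum k (V - C)"
proof -
  define key where "key h = restrict (\<lambda>v. coset R (h v)) (V - C)" for h :: "'a \<Rightarrow> rat"
  have "card (coset unweighted_lattice ` N) = card (key ` N)"
  proof (rule card_image_eq_if_same_fibres)
    fix g h assume gh: "g \<in> N" "h \<in> N"
    define d where "d = g - h"
    have dC: "d c = 0" if "c \<in> C" for c using gh that by (simp add: N_def d_def)
    have "coset unweighted_lattice g = coset unweighted_lattice h \<longleftrightarrow> (\<forall>e\<in>E. sum d e \<in> R)"
      by (simp only: coset_unweighted_eq_iff sum_diff_fun d_def)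
    also have "\<dots> \<longleftrightarrow> (\<forall>v\<in>V-C. d v \<in> R)"
    proof
      assume *: "\<forall>e\<in>E. sum d e \<in> R"
      note val = walk_value[where S = E and M = R and g = d, OF _ add_subgroup_p_integral bspec[OF *] edgeD(2)]
      show "\<forall>v\<in>V-C. d v \<in> R"
      proof
        fix v assume v: "v \<in> V - C"
        show "d v \<in> R"
        proof (cases "frustrated E v")
          case True
          thus ?thesis using val[of v True v] halve_R[of "d v"] by (simp add: frustrated_def)
        next
          case False
          then obtain c b where "c \<in> C" "parity_walk E v b c" using v C by (auto simp: meets_balanced_def)
          thus ?thesis using val[of v b c] dC by (auto split: if_splits)
        qed
      qed
    next
      assume *: "\<forall>v\<in>V-C. d v \<in> R"
      have dR: "d v \<in> R" if "v \<in> V" for v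
        using that * dC of_int_in_p_integral[of 0 p] by (cases "v \<in> C") auto
      show "\<forall>e\<in>E. sum d e \<in> R"
      proof
        fix e assume "e \<in> E"
        then obtain v w where "e = {v, w}" "v \<noteq> w" "v \<in> V" "w \<in> V" by (rule edgeE)
        thus "sum d e \<in> R" using dR add_subgroup_add[OF add_subgroup_p_integral] by simp
      qed
    qed
    also have "\<dots> \<longleftrightarrow> key g = key h"
      by (auto simp: key_def restrict_def fun_eq_iff coset_eq_iff[OF add_subgroup_p_integral] d_def)
    finally show "coset unweighted_lattice g = coset unweighted_lattice h \<longleftrightarrow> key g = key h" .
  qed
  also have "key ` N = PiE (V - C) (\<lambda>v. coset R ` p_fractional p (k v))"
  proof (intro equalityI subsetI)
    fix Y assume Y: "Y \<in> PiE (V - C) (\<lambda>v. coset R ` p_fractional p (k v))"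
    hence "\<forall>v\<in>V-C. \<exists>y. y \<in> p_fractional p (k v) \<and> Y v = coset R y" by (auto simp: PiE_iff)
    then obtain y where y: "\<And>v. v \<in> V - C \<Longrightarrow> y v \<in> p_fractional p (k v)"
      "\<And>v. v \<in> V - C \<Longrightarrow> Y v = coset R (y v)"
      by metis
    define h where "h v = (if v \<in> C then 0 else y v)" for v
    have "h \<in> N" using y add_subgroup_p_fractional[of p] by (auto simp: N_def h_def add_subgroup_def)
    moreover have "Y = key h"
      by (rule PiE_ext[OF Y])
        (use y in \<open>auto simp: key_def h_def\<close>)
    ultimately show "Y \<in> key ` N" by blast
  qed (auto simp: key_def N_def)
  also have "card \<dots> = p ^ sum k (V - C)"
    using finite_V by (intro card_PiE_fractional) simp
  finally show ?thesis .
qed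

lemma finite_index_unweighted_in_cocycle: "finite (coset unweighted_lattice ` cocycle_lattice)"
  by (rule index_unweighted_in_cocycle_attained) (use p_gt_0 in \<open>auto intro: card_ge_0_finite\<close>)

lemma index_unweighted_in_coboundary_ge:
  assumes "meets_balanced V E C"
  shows "p ^ sum k (V - C) \<le> card (coset unweighted_lattice ` coboundary_lattice)"
proof -
  have "finite (coset unweighted_lattice ` coboundary_lattice)"
    using finite_subset[OF image_mono[OF coboundary_subset_cocycle] finite_index_unweighted_in_cocycle] .
  moreover have "{h. (\<forall>v\<in>V. h v \<in> p_fractional p (k v)) \<and> (\<forall>c\<in>C. h c = 0)} \<subseteq> coboundary_lattice"
    unfolding coboundary_lattice_def by blast
  ultimately show ?thesis
    unfolding meets_balanced_card[OF assms, symmetric] by (intro card_mono image_mono)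
qed

text \<open>
  In each bipartite component a lightest vertex serves as root, and \<open>\<rho>\<close> subtracts the multiple of
  the sign function that makes \<open>g\<close> vanish at the root. The edge sums do not change. As the root is
  lightest, the value subtracted has no larger denominator than is allowed at any vertex of the
  component. A function with edge sums in \<open>R\<close> becomes \<open>R\<close>-valued because its values at two vertices of
  a component agree modulo \<open>R\<close> up to the sign.
\<close>

lemma balanced_normal_form:
  obtains C and \<rho> :: "('a \<Rightarrow> rat) \<Rightarrow> 'a \<Rightarrow> rat" where "meets_balanced V E C"
    "\<And>g e. e \<in> E \<Longrightarrow> sum (\<rho> g) e = sum g e"
    "\<And>g c. c \<in> C \<Longrightarrow> \<rho> g c = 0"
    "\<And>g v. (\<And>v. v \<in> V \<Longrightarrow> g v \<in> p_fractional p (k v)) \<Longrightarrow> v \<in> V \<Longrightarrow> \<rho> g v \<in> p_fractional p (k v)"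
    "\<And>g v. g \<in> unweighted_lattice \<Longrightarrow> v \<in> V \<Longrightarrow> \<rho> g v \<in> R"
proof -
  define comp where "comp v = {u. \<exists>b. parity_walk E v b u}" for v
  have comp_eq: "comp v = comp w" if "parity_walk E v b w" for v w b
    unfolding comp_def using parity_walk_trans[OF _ that] parity_walk_trans[OF _ parity_walk_sym[OF that]]
    by blast
  have comp_V: "u \<in> V" if "parity_walk E v b u" "v \<in> V" for u v b
    using that by (induction rule: parity_walk.induct) (use edgeD(1) in auto)
  \<comment> \<open>the root depends on the component only, which is why the ends of an edge have the same root\<close>
  define root where "root v = (ARG_MIN k u. u \<in> comp v)" for v
  have self: "v \<in> comp v" for v unfolding comp_def using parity_walk.refl by fast
  have root: "root v \<in> comp v" "k (root v) \<le> k v" for v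
    unfolding root_def using self[of v] by (auto intro: arg_min_natI arg_min_nat_le)
  have root_eq: "root v = root w" if "parity_walk E v b w" for v w b
    using comp_eq[OF that] by (simp add: root_def)
  have root_walk: "\<exists>b. parity_walk E v b (root v)" for v
    using root(1) by (auto simp: comp_def)
  have root_fr: "frustrated E (root v) \<longleftrightarrow> frustrated E v" for v
    using root_walk[of v] frustrated_walk[of E v] by metis
  define C where "C = root ` {v \<in> V. \<not> frustrated E v}"
  define \<rho> where "\<rho> g v = (if frustrated E v then g v else g v - walk_sign E (root v) v * g (root v))"
    for g and v
  show ?thesis
  proof (rule that[of C \<rho>])
    show "meets_balanced V E C"
      unfolding meets_balanced_def C_def using root_walk comp_V by blast
  next
    fix g e assume e: "e \<in> E"
    then obtain v w where vw: "e = {v, w}" "v \<noteq> w" by (rule edgeE)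
    have walk: "parity_walk E v True w" using e vw by (intro parity_walk_edge) simp
    show "sum (\<rho> g) e = sum g e"
    proof (cases "frustrated E v")
      case True
      thus ?thesis using vw frustrated_walk[OF walk] by (simp add: \<rho>_def)
    next
      case False
      have "walk_sign E (root v) v + walk_sign E (root v) w = 0"
        using walk_sign_edge[of E "root v" e] False e edgeD root_fr[of v] vw by simp
      hence "walk_sign E (root v) v * g (root v) + walk_sign E (root v) w * g (root v) = 0"
        by (metis distrib_right mult_zero_left)
      thus ?thesis using vw frustrated_walk[OF walk] False root_eq[OF walk] by (simp add: \<rho>_def)
    qed
  next
    fix g c assume "c \<in> C"
    then obtain v where v: "c = root v" "\<not> frustrated E v" by (auto simp: C_def)
    have "root c = c" using root_walk[of v] root_eq v by metis
    thus "\<rho> g c = 0" using v root_fr parity_walk.refl[of E c] by (simp add: \<rho>_def walk_sign_def)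
  next
    fix g :: "'a \<Rightarrow> rat" and v
    assume g: "\<And>v. v \<in> V \<Longrightarrow> g v \<in> p_fractional p (k v)" and v: "v \<in> V"
    have "root v \<in> V" using root_walk comp_V v by blast
    hence r: "g (root v) \<in> p_fractional p (k v)"
      using g p_fractional_mono[OF root(2)] by blast
    show "\<rho> g v \<in> p_fractional p (k v)"
      using add_subgroup_diff[OF add_subgroup_p_fractional g[OF v] r]
        add_subgroup_add[OF add_subgroup_p_fractional g[OF v] r] g[OF v]
      by (auto simp: \<rho>_def walk_sign_def)
  next
    fix g v assume g: "g \<in> unweighted_lattice" and v: "v \<in> V"
    note val = walk_value[where S = E and M = R and g = g, OF _ add_subgroup_p_integral _ edgeD(2)]
    show "\<rho> g v \<in> R"
    proof (cases "frustrated E v")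
      case True
      thus ?thesis using val[of v True v] halve_R[of "g v"] g by (simp add: frustrated_def \<rho>_def unweighted_lattice_def)
    next
      case False
      obtain b where b: "parity_walk E v b (root v)" using root_walk by blast
      have "parity_walk E (root v) c v \<longleftrightarrow> c = b" for c
        using not_frustrated_parity_unique[of E "root v"] root_fr False parity_walk_sym[OF b] by blast
      thus ?thesis using val[OF b] g False by (cases b) (auto simp: \<rho>_def walk_sign_def unweighted_lattice_def)
    qed
  qed
qed

text \<open>
  Apart from \<open>2\<close>, the unweighted coboundary has no torsion in its cokernel: the normal form of a
  function with edge sums in \<open>R\<close> is \<open>R\<close>-valued.
\<close>

lemma unweighted_subset_coboundary: "unweighted_lattice \<subseteq> coboundary_lattice"
proof
  fix g assume g: "g \<in> unweighted_lattice"
  obtain C and \<rho> :: "('a \<Rightarrow> rat) \<Rightarrow> 'a \<Rightarrow> rat" where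
    \<rho>: "\<And>g e. e \<in> E \<Longrightarrow> sum (\<rho> g) e = sum g e" "\<And>g v. g \<in> unweighted_lattice \<Longrightarrow> v \<in> V \<Longrightarrow> \<rho> g v \<in> R"
    using balanced_normal_form by metis
  have "\<rho> g v \<in> p_fractional p (k v)" if "v \<in> V" for v
    using \<rho>(2)[OF g that] p_fractional_mono[of 0 "k v" p] by (auto simp: p_fractional_0)
  thus "g \<in> coboundary_lattice" using \<rho>(1)
    unfolding coboundary_lattice_def by (intro CollectI exI[of _ "\<rho> g"]) simp
qed

lemma index_unweighted_in_coboundary_attained:
  obtains C where "meets_balanced V E C" "card (coset unweighted_lattice ` coboundary_lattice) = p ^ sum k (V - C)"
proof -
  obtain C and \<rho> :: "('a \<Rightarrow> rat) \<Rightarrow> 'a \<Rightarrow> rat" where C: "meets_balanced V E C" and \<rho>: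
    "\<And>g e. e \<in> E \<Longrightarrow> sum (\<rho> g) e = sum g e" "\<And>g c. c \<in> C \<Longrightarrow> \<rho> g c = 0"
    "\<And>g v. (\<And>v. v \<in> V \<Longrightarrow> g v \<in> p_fractional p (k v)) \<Longrightarrow> v \<in> V \<Longrightarrow> \<rho> g v \<in> p_fractional p (k v)"
    by (rule balanced_normal_form) blast
  \<comment> \<open>the normal forms of the functions in the coboundary lattice; they already meet all its cosets\<close>
  define N where "N = {h. (\<forall>v\<in>V. h v \<in> p_fractional p (k v)) \<and> (\<forall>c\<in>C. h c = 0)}"
  have "coset unweighted_lattice ` coboundary_lattice \<subseteq> coset unweighted_lattice ` N"
  proof (intro image_subsetI)
    fix g assume "g \<in> coboundary_lattice"
    then obtain h where h: "\<And>v. v \<in> V \<Longrightarrow> h v \<in> p_fractional p (k v)" "\<And>e. e \<in> E \<Longrightarrow> sum g e = sum h e"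
      by (auto simp: coboundary_lattice_def)
    have "\<rho> h \<in> N" using \<rho> h by (auto simp: N_def)
    moreover have "coset unweighted_lattice g = coset unweighted_lattice (\<rho> h)"
      using \<rho>(1) h(2) of_int_in_p_integral[of 0 p]
      by (simp add: coset_unweighted_eq_iff)
    ultimately show "coset unweighted_lattice g \<in> coset unweighted_lattice ` N" by blast
  qed
  moreover have "N \<subseteq> coboundary_lattice" unfolding coboundary_lattice_def N_def by blast
  ultimately have "coset unweighted_lattice ` coboundary_lattice = coset unweighted_lattice ` N" by blast
  thus ?thesis using that C meets_balanced_card[OF C] by (simp add: N_def)
qed

end

section \<open>Torsion classes and their potentials\<close>

text \<open>
  Only the terms of the two ends of an edge contribute to the coefficient at the edge.
\<close>

lemma lookup_coboundary0:
  assumes G: "finite_simple_graph V E" and f: "Poly_Mapping.keys f \<subseteq> V"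
    and e: "{v, w} \<in> E" "v \<noteq> w"
  shows "Poly_Mapping.lookup (coboundary0 V E k f) {v, w} =
    Poly_Mapping.lookup f v * int (k w) + Poly_Mapping.lookup f w * int (k v)"
proof -
  have fin: "finite V" and vw: "v \<in> V" "w \<in> V" using G e by (auto simp: finite_simple_graph_def)
  define star where "star u = (\<Sum>x\<in>{x \<in> V. {u, x} \<in> E}. frag_cmul (int (k x)) (frag_of {u, x}))" for u
  have star: "Poly_Mapping.lookup (star u) {v, w} = (if u = v then int (k w) else if u = w then int (k v) else 0)" for u
  proof -
    \<comment> \<open>the neighbour \<open>x = t\<close> is the only one that can give \<open>{u, x} = {v, w}\<close>\<close>
    define t where "t = (if u = v then w else v)"
    have "Poly_Mapping.lookup (star u) {v, w} = (\<Sum>x\<in>{x \<in> V. {u, x} \<in> E}.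
        if x = t then (if {u, t} = {v, w} then int (k t) else 0) else 0)"
      unfolding star_def lookup_sum
      by (rule sum.cong) (use e(2) in \<open>auto simp: t_def doubleton_eq_iff\<close>)
    also have "\<dots> = (if t \<in> V \<and> {u, t} \<in> E then (if {u, t} = {v, w} then int (k t) else 0) else 0)"
      using fin by (subst sum.delta) auto
    also have "\<dots> = (if u = v then int (k w) else if u = w then int (k v) else 0)"
      using e vw by (auto simp: t_def doubleton_eq_iff insert_commute)
    finally show ?thesis .
  qed
  have "coboundary0 V E k f = (\<Sum>u\<in>V. frag_cmul (Poly_Mapping.lookup f u) (star u))"
    unfolding coboundary0_def frag_extend_def star_def[symmetric]
    by (rule sum.mono_neutral_left) (use fin f in \<open>auto simp: in_keys_iff\<close>)
  hence "Poly_Mapping.lookup (coboundary0 V E k f) {v, w} =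
      (\<Sum>u\<in>V. Poly_Mapping.lookup f u * Poly_Mapping.lookup (star u) {v, w})"
    by (simp add: lookup_sum)
  also have "\<dots> = (\<Sum>u\<in>{v, w}. Poly_Mapping.lookup f u * Poly_Mapping.lookup (star u) {v, w})"
    by (rule sum.mono_neutral_right) (use fin vw in \<open>auto simp: star\<close>)
  finally show ?thesis using e(2) by (simp add: star)
qed

lemma keys_coboundary0: "Poly_Mapping.keys (coboundary0 V E k f) \<subseteq> E"
proof
  fix e assume "e \<in> Poly_Mapping.keys (coboundary0 V E k f)"
  hence "Poly_Mapping.lookup (coboundary0 V E k f) e \<noteq> 0" by (simp add: in_keys_iff)
  moreover have "Poly_Mapping.lookup (coboundary0 V E k f) e = 0" if "e \<notin> E"
    unfolding coboundary0_def frag_extend_def lookup_sum lookup_frag_cmul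
    by (intro sum.neutral ballI) (use that in \<open>auto intro!: sum.neutral\<close>)
  ultimately show "e \<in> E" by blast
qed

lemma ex_frag_with_values:
  fixes f :: "'b \<Rightarrow> rat"
  assumes "finite A" "\<And>a. a \<in> A \<Longrightarrow> f a \<in> \<int>"
  obtains x where "Poly_Mapping.keys x \<subseteq> A" "\<And>a. a \<in> A \<Longrightarrow> of_int (Poly_Mapping.lookup x a) = f a"
proof -
  define x where "x = Abs_poly_mapping (\<lambda>a. if a \<in> A then \<lfloor>f a\<rfloor> else 0)"
  have "{a. (if a \<in> A then \<lfloor>f a\<rfloor> else 0) \<noteq> 0} \<subseteq> A" by auto
  hence "Poly_Mapping.lookup x = (\<lambda>a. if a \<in> A then \<lfloor>f a\<rfloor> else 0)"
    unfolding x_def using assms(1) finite_subset by (intro lookup_Abs_poly_mapping) blast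
  moreover have "of_int \<lfloor>f a\<rfloor> = f a" if "a \<in> A" for a
    using assms(2)[OF that] by (auto elim: Ints_cases)
  ultimately show ?thesis by (intro that[of x]) (auto simp: in_keys_iff split: if_splits)
qed

text \<open>
  Translates the torsion of the quotient group into cosets in the ambient additive group.
\<close>

lemma primary_torsion_Mod_free_Abelian_group:
  assumes H: "subgroup H (free_Abelian_group A)"
  shows "primary_torsion p (free_Abelian_group A Mod H) =
    coset H ` {x. Poly_Mapping.keys x \<subseteq> A \<and> (\<exists>n. frag_cmul (int (p ^ n)) x \<in> H)}"
proof -
  let ?G = "free_Abelian_group A"
  interpret G: comm_group ?G by (rule abelian_free_Abelian_group)
  have N: "H \<lhd> ?G" using H by (rule G.subgroup_imp_normal)
  have c: "H #>\<^bsub>?G\<^esub> x = coset H x" for x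
    by (force simp: r_coset_def coset_def)
  have "coset H x [^]\<^bsub>?G Mod H\<^esub> (p ^ n) = coset H (frag_cmul (int (p ^ n)) x)"
    if "x \<in> carrier ?G" for x n
    using normal.FactGroup_pow[OF N that, of "p ^ n"] unfolding c by (simp only: pow_free_Abelian_group)
  moreover have "coset H y = H \<longleftrightarrow> y \<in> H" if "y \<in> carrier ?G" for y
    using that H c by (metis G.coset_join1 G.coset_join2 G.is_group subgroup.subset)
  ultimately have key: "coset H x [^]\<^bsub>?G Mod H\<^esub> (p ^ n) = H \<longleftrightarrow> frag_cmul (int (p ^ n)) x \<in> H"
    if "x \<in> carrier ?G" for x n
    using that by (metis G.nat_pow_closed pow_free_Abelian_group)
  have "primary_torsion p (?G Mod H) =
      coset H ` {x \<in> carrier ?G. \<exists>n. coset H x [^]\<^bsub>?G Mod H\<^esub> (p ^ n) = H}"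
    unfolding primary_torsion_def carrier_FactGroup c one_FactGroup by (rule Compr_image_eq)
  also have "{x \<in> carrier ?G. \<exists>n. coset H x [^]\<^bsub>?G Mod H\<^esub> (p ^ n) = H} =
      {x. Poly_Mapping.keys x \<subseteq> A \<and> (\<exists>n. frag_cmul (int (p ^ n)) x \<in> H)}"
    by (rule Collect_cong) (metis key carrier_free_Abelian_group_iff)
  finally show ?thesis .
qed

context prime_weighted_graph
begin

abbreviation d where "d \<equiv> coboundary0 V E (\<lambda>v. p ^ k v)"

definition coboundaries :: "('a set \<Rightarrow>\<^sub>0 int) set" where
  "coboundaries = d ` {f. Poly_Mapping.keys f \<subseteq> V}"

definition torsion_cocycles :: "('a set \<Rightarrow>\<^sub>0 int) set" where
  "torsion_cocycles = {x. Poly_Mapping.keys x \<subseteq> E \<and> (\<exists>n. frag_cmul (int (p ^ n)) x \<in> coboundaries)}"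

text \<open>
  A potential of \<open>x\<close> is a rational primitive of \<open>x\<close> in the rescaled coordinates \<open>f v / p ^ k v\<close>. The
  cochains that have one are those that represent torsion of any order in the cohomology.
\<close>

definition potential :: "('a set \<Rightarrow>\<^sub>0 int) \<Rightarrow> ('a \<Rightarrow> rat) \<Rightarrow> bool" where
  "potential x g \<longleftrightarrow> (\<forall>e\<in>E. of_int (Poly_Mapping.lookup x e) = of_nat p ^ sum k e * sum g e)"

lemma potential_coboundary:
  assumes "Poly_Mapping.keys f \<subseteq> V"
  shows "potential (d f) (\<lambda>v. of_int (Poly_Mapping.lookup f v) / of_nat p ^ k v)"
  unfolding potential_def
proof
  fix e assume e: "e \<in> E"
  then obtain v w where vw: "e = {v, w}" "v \<noteq> w" by (rule edgeE)
  thus "of_int (Poly_Mapping.lookup (d f) e) =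
      of_nat p ^ sum k e * (\<Sum>v\<in>e. of_int (Poly_Mapping.lookup f v) / of_nat p ^ k v :: rat)"
    using lookup_coboundary0[OF graph assms, of v w "\<lambda>v. p ^ k v"] e p_gt_0
    by (simp add: power_add field_simps)
qed

lemma potential_unique:
  assumes "potential x g" "potential x h" "e \<in> E"
  shows "sum g e = sum h e"
proof -
  have "of_nat p ^ sum k e * sum g e = of_nat p ^ sum k e * sum h e"
    using assms unfolding potential_def by metis
  thus ?thesis using p_gt_0 by simp
qed

lemma potential_diff: "potential x g \<Longrightarrow> potential y h \<Longrightarrow> potential (x - y) (g - h)"
  by (simp add: potential_def lookup_minus sum_subtractf right_diff_distrib)

lemma potential_determines:
  assumes "potential x g" "potential y h" "\<And>e. e \<in> E \<Longrightarrow> sum g e = sum h e"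
    "Poly_Mapping.keys x \<subseteq> E" "Poly_Mapping.keys y \<subseteq> E"
  shows "x = y"
proof (rule poly_mapping_eqI)
  fix e
  show "Poly_Mapping.lookup x e = Poly_Mapping.lookup y e"
  proof (cases "e \<in> E")
    case True
    hence "(of_int (Poly_Mapping.lookup x e) :: rat) = of_int (Poly_Mapping.lookup y e)"
      using assms(1-3) by (simp add: potential_def)
    thus ?thesis by simp
  next
    case False
    thus ?thesis using assms(4,5) by (metis in_keys_iff subsetD)
  qed
qed

lemma coboundaries_cmul: "x \<in> coboundaries \<Longrightarrow> frag_cmul a x \<in> coboundaries"
  unfolding coboundaries_def coboundary0_def using keys_cmul
  by (auto simp flip: frag_extend_cmul)

lemma coboundaries_add: "x \<in> coboundaries \<Longrightarrow> y \<in> coboundaries \<Longrightarrow> x + y \<in> coboundaries"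
proof -
  assume "x \<in> coboundaries" "y \<in> coboundaries"
  then obtain f g where f: "Poly_Mapping.keys f \<subseteq> V" "x = d f" and g: "Poly_Mapping.keys g \<subseteq> V" "y = d g"
    by (auto simp: coboundaries_def)
  have "Poly_Mapping.keys (f + g) \<subseteq> V" using keys_add[of f g] f(1) g(1) by blast
  moreover have "x + y = d (f + g)" unfolding f g coboundary0_def by (rule frag_extend_add[symmetric])
  ultimately show "x + y \<in> coboundaries" by (simp add: coboundaries_def)
qed

lemma keys_coboundaries: "x \<in> coboundaries \<Longrightarrow> Poly_Mapping.keys x \<subseteq> E"
  using keys_coboundary0[of V E "\<lambda>v. p ^ k v"] unfolding coboundaries_def by blast

lemma add_subgroup_coboundaries: "add_subgroup coboundaries"
proof -
  have "0 \<in> coboundaries" unfolding coboundaries_def coboundary0_def by (auto intro!: image_eqI[of _ _ 0])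
  moreover have "x - y \<in> coboundaries" if "x \<in> coboundaries" "y \<in> coboundaries" for x y
    using coboundaries_add[OF that(1) coboundaries_cmul[OF that(2), of "-1"]] by simp
  ultimately show ?thesis by (simp add: add_subgroup_def)
qed

lemma subgroup_coboundaries: "subgroup coboundaries (free_Abelian_group E)"
proof (rule group.subgroupI[OF group_free_Abelian_group])
  show "coboundaries \<subseteq> carrier (free_Abelian_group E)"
    using keys_coboundaries by auto
  show "coboundaries \<noteq> {}" using add_subgroup_coboundaries by (auto simp: add_subgroup_def)
next
  fix x y assume xy: "x \<in> coboundaries" "y \<in> coboundaries"
  show "x \<otimes>\<^bsub>free_Abelian_group E\<^esub> y \<in> coboundaries" using coboundaries_add xy by simp
  have "Poly_Mapping.keys x \<subseteq> E" using xy(1) by (rule keys_coboundaries)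
  thus "inv\<^bsub>free_Abelian_group E\<^esub> x \<in> coboundaries"
    using coboundaries_cmul[OF xy(1), of "-1"] by simp
qed

text \<open>
  Multiples by coprime integers generate the cochain itself. With powers of \<open>p\<close> on one side, this
  removes denominators prime to \<open>p\<close>.
\<close>

lemma coboundaries_coprime:
  assumes "coprime a b" "frag_cmul a x \<in> coboundaries" "frag_cmul b x \<in> coboundaries"
  shows "x \<in> coboundaries"
proof -
  obtain s t where st: "s * a + t * b = 1" using bezout_int[of a b] assms(1) by auto
  have "frag_cmul s (frag_cmul a x) + frag_cmul t (frag_cmul b x) \<in> coboundaries"
    by (rule coboundaries_add; rule coboundaries_cmul; fact)
  thus ?thesis using st by (simp flip: frag_cmul_distrib)
qed

lemma torsion_cocycle_potential:
  assumes "x \<in> torsion_cocycles"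
  obtains g where "potential x g"
proof -
  obtain n f where f: "Poly_Mapping.keys f \<subseteq> V" "frag_cmul (int (p ^ n)) x = d f"
    using assms by (auto simp: torsion_cocycles_def coboundaries_def)
  define g where "g v = of_int (Poly_Mapping.lookup f v) / of_nat p ^ k v / (of_nat p ^ n :: rat)" for v
  have "potential x g" unfolding potential_def
  proof
    fix e assume "e \<in> E"
    hence "of_nat p ^ n * (of_int (Poly_Mapping.lookup x e) :: rat) =
        of_nat p ^ sum k e * (\<Sum>v\<in>e. of_int (Poly_Mapping.lookup f v) / of_nat p ^ k v)"
      using potential_coboundary[OF f(1)] unfolding f(2)[symmetric] by (simp add: potential_def)
    also have "(\<Sum>v\<in>e. of_int (Poly_Mapping.lookup f v) / of_nat p ^ k v) = of_nat p ^ n * sum g e"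
      using p_gt_0 by (simp add: g_def sum_distrib_left)
    finally have "of_nat p ^ n * (of_int (Poly_Mapping.lookup x e)
        :: rat) = of_nat p ^ n * (of_nat p ^ sum k e * sum g e)"
      by (simp only: mult.left_commute)
    thus "of_int (Poly_Mapping.lookup x e) = of_nat p ^ sum k e * sum g e"
      using p_gt_0 by simp
  qed
  thus ?thesis using that by blast
qed

lemma potential_in_cocycle_lattice:
  assumes "potential x g"
  shows "g \<in> cocycle_lattice"
  unfolding cocycle_lattice_def
proof (intro CollectI ballI)
  fix e assume "e \<in> E"
  thus "sum g e \<in> p_fractional p (sum k e)"
    using assms of_int_in_p_integral[of "Poly_Mapping.lookup x e" p]
    by (simp add: p_fractional_def potential_def)
qed

text \<open>
  A cochain of \<open>p\<close>-primary torsion is a coboundary over the integers as soon as it is one over \<open>R\<close>: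
  some multiple by an integer \<open>b\<close> prime to \<open>p\<close> and some multiple by a power of \<open>p\<close> are
  coboundaries.
\<close>

lemma torsion_coboundary_iff:
  assumes x: "Poly_Mapping.keys x \<subseteq> E" "frag_cmul (int (p ^ n)) x \<in> coboundaries" and g: "potential x g"
  shows "x \<in> coboundaries \<longleftrightarrow> g \<in> coboundary_lattice"
proof
  assume "x \<in> coboundaries"
  then obtain f where f: "Poly_Mapping.keys f \<subseteq> V" "x = d f" by (auto simp: coboundaries_def)
  show "g \<in> coboundary_lattice" unfolding coboundary_lattice_def
  proof (intro CollectI exI conjI ballI)
    fix v
    show "of_int (Poly_Mapping.lookup f v) / of_nat p ^ k v \<in> p_fractional p (k v)"
      using p_gt_0 of_int_in_p_integral by (simp add: p_fractional_def)
  next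
    fix e assume "e \<in> E"
    thus "sum g e = (\<Sum>v\<in>e. of_int (Poly_Mapping.lookup f v) / of_nat p ^ k v)"
      using potential_unique[OF g] potential_coboundary[OF f(1)] f(2) by blast
  qed
next
  assume "g \<in> coboundary_lattice"
  then obtain h where h: "\<And>v. v \<in> V \<Longrightarrow> h v \<in> p_fractional p (k v)" "\<And>e. e \<in> E \<Longrightarrow> sum g e = sum h e"
    by (auto simp: coboundary_lattice_def)
  obtain b where b: "coprime b (int p)" "\<And>v. v \<in> V \<Longrightarrow> of_int b * (of_nat p ^ k v * h v) \<in> \<int>"
    by (rule p_integral_common_denominator[OF finite_V, of "\<lambda>v. of_nat p ^ k v * h v" p])
      (use h(1) in \<open>auto simp: p_fractional_def\<close>)
  obtain f where f: "Poly_Mapping.keys f \<subseteq> V"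
    "\<And>v. v \<in> V \<Longrightarrow> of_int (Poly_Mapping.lookup f v) = of_int b * (of_nat p ^ k v * h v)"
    using ex_frag_with_values[OF finite_V, of "\<lambda>v. of_int b * (of_nat p ^ k v * h v)"] b(2) by metis
  have fv: "of_int (Poly_Mapping.lookup f v) / of_nat p ^ k v = of_int b * h v" if "v \<in> V" for v
    using f(2)[OF that] p_gt_0 by simp
  have "frag_cmul b x = d f"
  proof (rule potential_determines[OF _ potential_coboundary[OF f(1)]])
    show "potential (frag_cmul b x) (\<lambda>v. of_int b * g v)"
      using g by (simp add: potential_def sum_distrib_left[symmetric] mult.left_commute)
    fix e assume e: "e \<in> E"
    have "(\<Sum>v\<in>e. of_int (Poly_Mapping.lookup f v) / of_nat p ^ k v) = (\<Sum>v\<in>e. of_int b * h v)"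
      using edgeD[OF e] fv by (intro sum.cong) auto
    thus "(\<Sum>v\<in>e. of_int b * g v) = (\<Sum>v\<in>e. of_int (Poly_Mapping.lookup f v) / of_nat p ^ k v)"
      using h(2)[OF e] by (simp add: sum_distrib_left[symmetric])
  qed (rule order.trans[OF keys_cmul x(1)], rule keys_coboundary0)
  hence "frag_cmul b x \<in> coboundaries" using f(1) by (auto simp: coboundaries_def)
  moreover have "coprime b (int (p ^ n))" using b(1) by simp
  ultimately show "x \<in> coboundaries" using x(2) coboundaries_coprime by blast
qed

lemma rat_p_fractional: "\<exists>n. (x::rat) \<in> p_fractional p n"
proof -
  obtain a c where ac: "quotient_of x = (a, c)" by force
  have x: "x = of_int a / of_int c" "c > 0" using quotient_of_div[OF ac] quotient_of_denom_pos[OF ac] .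
  have "\<not> is_unit (int p)" using p_gt_1 by simp
  then obtain m where m: "c = int p ^ multiplicity (int p) c * m" "\<not> int p dvd m"
    using multiplicity_decompose'[of c "int p"] x(2) by (metis less_irrefl)
  have "coprime m (int p)" using prime_imp_coprime[of "int p" m] m(2) prime
    by (simp add: coprime_commute)
  moreover have "of_int m * (of_nat p ^ multiplicity (int p) c * x) = of_int a"
  proof -
    have "of_int m * (of_nat p ^ multiplicity (int p) c) = (of_int c :: rat)"
      by (subst (2) m(1)) simp
    thus ?thesis using x by (simp add: mult.assoc[symmetric])
  qed
  ultimately have "x \<in> p_fractional p (multiplicity (int p) c)"
    unfolding p_fractional_def by (auto intro: p_integralI[of m])
  thus ?thesis ..
qed

text \<open>
  Every coset of the coboundary lattice in the cocycle lattice contains a potential of an integral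
  cochain of \<open>p\<close>-primary torsion. An integer \<open>q\<close> that clears the denominators prime to \<open>p\<close> can be
  chosen congruent to \<open>1\<close> modulo the power \<open>p ^ n\<close> that clears the rest; then \<open>q g\<close> is integral enough
  to be a potential of a torsion cochain and \<open>g - q g\<close>, a multiple of \<open>p ^ n g\<close>, comes from an
  \<open>R\<close>-valued function.
\<close>

lemma cocycle_lattice_approximated_by_potential:
  assumes g: "g \<in> cocycle_lattice"
  obtains x h n where "Poly_Mapping.keys x \<subseteq> E" "frag_cmul (int (p ^ n)) x \<in> coboundaries"
      "potential x h" "g - h \<in> coboundary_lattice"
proof -
  obtain b where b: "coprime b (int p)" "\<And>e. e \<in> E \<Longrightarrow> of_int b * (of_nat p ^ sum k e * sum g e) \<in> \<int>"
    by (rule p_integral_common_denominator[OF finite_E, of "\<lambda>e. of_nat p ^ sum k e * sum g e" p])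
      (use g in \<open>auto simp: cocycle_lattice_def p_fractional_def\<close>)
  obtain M where M: "\<And>x :: rat. x \<in> p_fractional p (M x)"
    using rat_p_fractional by metis
  define N where "N v = M (of_nat p ^ k v * g v)" for v
  have N: "of_nat p ^ k v * g v \<in> p_fractional p (N v)" for v
    unfolding N_def by (rule M)
  define n where "n = Max (insert 0 (N ` V))"
  have n: "of_nat p ^ n * (of_nat p ^ k v * g v) \<in> R" if "v \<in> V" for v
  proof -
    have "N v \<le> n" using that finite_V by (simp add: n_def)
    from p_fractional_mono[OF this] N[of v] show ?thesis by (auto simp: p_fractional_def)
  qed
  obtain m where m: "coprime m (int p)" "\<And>v. v \<in> V \<Longrightarrow> of_int m * (of_nat p ^ n * (of_nat p ^ k v * g v)) \<in> \<int>"
    by (rule p_integral_common_denominator[OF finite_V, of "\<lambda>v. of_nat p ^ n * (of_nat p ^ k v * g v)" p])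
      (use n in auto)
  \<comment> \<open>\<open>b m\<close> clears all denominators prime to \<open>p\<close>; its multiple \<open>q\<close> is \<open>1\<close> modulo \<open>p ^ n\<close>\<close>
  have "coprime (b * m) (int p ^ n)" using b(1) m(1) by simp
  then obtain c u where cu: "c * (b * m) + u * int p ^ n = 1" using bezout_int[of "b * m" "int p ^ n"] by auto
  define q where "q = c * (b * m)"
  have q: "q = 1 - u * int p ^ n" using cu by (simp add: q_def)
  have qe: "of_int q * (of_nat p ^ sum k e * sum g e) \<in> \<int>" if "e \<in> E" for e
  proof -
    have "of_int q * (of_nat p ^ sum k e * sum g e) = of_int (c * m) * (of_int b * (of_nat p ^ sum k e * sum g e))"
      by (simp add: q_def)
    also have "\<dots> \<in> \<int>" using b(2)[OF that] by (rule Ints_mult[OF Ints_of_int])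
    finally show ?thesis .
  qed
  have qv: "of_int q * (of_nat p ^ n * (of_nat p ^ k v * g v)) \<in> \<int>" if "v \<in> V" for v
  proof -
    have "of_int q * (of_nat p ^ n * (of_nat p ^ k v * g v))
        = of_int (c * b) * (of_int m * (of_nat p ^ n * (of_nat p ^ k v * g v)))"
      by (simp add: q_def)
    also have "\<dots> \<in> \<int>" using m(2)[OF that] by (rule Ints_mult[OF Ints_of_int])
    finally show ?thesis .
  qed
  \<comment> \<open>\<open>q g\<close> has integral weighted edge sums, and \<open>p ^ n q g\<close> comes from an integral vertex function\<close>
  define h where "h v = of_int q * g v" for v
  have sum_h: "sum h e = of_int q * sum g e" for e
    by (simp add: h_def sum_distrib_left)
  obtain x where x: "Poly_Mapping.keys x \<subseteq> E"
    "\<And>e. e \<in> E \<Longrightarrow> of_int (Poly_Mapping.lookup x e) = of_int q * (of_nat p ^ sum k e * sum g e)"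
    using ex_frag_with_values[OF finite_E, of "\<lambda>e. of_int q * (of_nat p ^ sum k e * sum g e)"] qe by metis
  have px: "potential x h" unfolding potential_def
    using x(2) by (simp add: sum_h)
  obtain f where f: "Poly_Mapping.keys f \<subseteq> V"
    "\<And>v. v \<in> V \<Longrightarrow> of_int (Poly_Mapping.lookup f v) = of_int q * (of_nat p ^ n * (of_nat p ^ k v * g v))"
    using ex_frag_with_values[OF finite_V, of "\<lambda>v. of_int q * (of_nat p ^ n * (of_nat p ^ k v * g v))"] qv by metis
  have fv: "of_int (Poly_Mapping.lookup f v) / of_nat p ^ k v = of_nat p ^ n * h v" if "v \<in> V" for v
    using f(2)[OF that] p_gt_0 by (simp add: h_def)
  have "frag_cmul (int (p ^ n)) x = d f"
  proof (rule potential_determines[OF _ potential_coboundary[OF f(1)]])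
    show "potential (frag_cmul (int (p ^ n)) x) (\<lambda>v. of_nat p ^ n * h v)"
      using px by (simp add: potential_def sum_distrib_left[symmetric] mult.left_commute)
    fix e assume e: "e \<in> E"
    show "(\<Sum>v\<in>e. of_nat p ^ n * h v) = (\<Sum>v\<in>e. of_int (Poly_Mapping.lookup f v) / of_nat p ^ k v)"
      using edgeD[OF e] fv by (intro sum.cong) auto
  qed (rule order.trans[OF keys_cmul x(1)], rule keys_coboundary0)
  hence "frag_cmul (int (p ^ n)) x \<in> coboundaries" using f(1) by (auto simp: coboundaries_def)
  moreover have "g - h \<in> coboundary_lattice" unfolding coboundary_lattice_def
  proof (intro CollectI exI conjI ballI)
    fix v assume "v \<in> V"
    from p_integral_mult_int[OF n[OF this], of u]
    show "of_int (u * int p ^ n) * g v \<in> p_fractional p (k v)"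
      by (simp add: p_fractional_def mult_ac)
  next
    fix e
    show "sum (g - h) e = (\<Sum>v\<in>e. of_int (u * int p ^ n) * g v)"
      by (rule sum.cong) (simp_all add: h_def q algebra_simps)
  qed
  ultimately show ?thesis using that x(1) px by blast
qed

text \<open>
  A torsion class is determined by the coset of any of its potentials modulo the coboundary lattice,
  and all cosets in the cocycle lattice occur.
\<close>

lemma card_primary_torsion:
  "card (primary_torsion p (graph_H1 V E (\<lambda>v. p ^ k v))) = card (coset coboundary_lattice ` cocycle_lattice)"
proof -
  define pot where "pot x = (SOME g. potential x g)" for x
  have pot: "potential x (pot x)" if "x \<in> torsion_cocycles" for x
    unfolding pot_def using torsion_cocycle_potential[OF that] someI by metis
  have "{f. Poly_Mapping.keys f \<subseteq> V} = carrier (free_Abelian_group V)" by auto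
  hence "primary_torsion p (graph_H1 V E (\<lambda>v. p ^ k v)) = coset coboundaries ` torsion_cocycles"
    using primary_torsion_Mod_free_Abelian_group[OF subgroup_coboundaries, of p]
    by (simp add: graph_H1_def torsion_cocycles_def coboundaries_def)
  also have "card \<dots> = card ((\<lambda>x. coset coboundary_lattice (pot x)) ` torsion_cocycles)"
  proof (rule card_image_eq_if_same_fibres)
    fix x y assume xy: "x \<in> torsion_cocycles" "y \<in> torsion_cocycles"
    obtain m n where mn: "frag_cmul (int (p ^ m)) x \<in> coboundaries" "frag_cmul (int (p ^ n)) y \<in> coboundaries"
      using xy by (auto simp: torsion_cocycles_def)
    \<comment> \<open>\<open>x - y\<close> is again a torsion cochain, with the sum of the two exponents\<close>
    have eq: "frag_cmul (int (p ^ n)) (frag_cmul (int (p ^ m)) x)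
          - frag_cmul (int (p ^ m)) (frag_cmul (int (p ^ n)) y)
        = frag_cmul (int (p ^ (n + m))) (x - y)"
      by (rule poly_mapping_eqI) (simp add: lookup_minus power_add algebra_simps)
    have "frag_cmul (int (p ^ (n + m))) (x - y) \<in> coboundaries"
      unfolding eq[symmetric]
      by (rule add_subgroup_diff[OF add_subgroup_coboundaries]; rule coboundaries_cmul; fact)
    moreover have "Poly_Mapping.keys (x - y) \<subseteq> E"
      using xy keys_diff[of x y] by (auto simp: torsion_cocycles_def)
    ultimately have "x - y \<in> coboundaries \<longleftrightarrow> pot x - pot y \<in> coboundary_lattice"
      using potential_diff[OF pot[OF xy(1)] pot[OF xy(2)]] by (intro torsion_coboundary_iff)
    thus "coset coboundaries x = coset coboundaries y \<longleftrightarrow>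
        coset coboundary_lattice (pot x) = coset coboundary_lattice (pot y)"
      by (simp add: coset_eq_iff add_subgroup_coboundaries add_subgroup_coboundary_lattice)
  qed
  also have "(\<lambda>x. coset coboundary_lattice (pot x)) ` torsion_cocycles = coset coboundary_lattice ` cocycle_lattice"
  proof (intro equalityI subsetI)
    fix A assume "A \<in> coset coboundary_lattice ` cocycle_lattice"
    then obtain g where g: "g \<in> cocycle_lattice" "A = coset coboundary_lattice g" by blast
    obtain x h n where xh: "Poly_Mapping.keys x \<subseteq> E" "frag_cmul (int (p ^ n)) x \<in> coboundaries"
      "potential x h" "g - h \<in> coboundary_lattice"
      by (rule cocycle_lattice_approximated_by_potential[OF g(1)])
    have x: "x \<in> torsion_cocycles" using xh by (auto simp: torsion_cocycles_def)
    have "sum (g - h) e = sum (g - pot x) e" if "e \<in> E" for e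
      using potential_unique[OF xh(3) pot[OF x] that] by (simp add: sum_subtractf)
    hence "g - pot x \<in> coboundary_lattice" using xh(4) unfolding coboundary_lattice_def by auto
    hence "A = coset coboundary_lattice (pot x)" using g(2) by (simp add: coset_eq_iff add_subgroup_coboundary_lattice)
    thus "A \<in> (\<lambda>x. coset coboundary_lattice (pot x)) ` torsion_cocycles" using x by blast
  qed (use pot potential_in_cocycle_lattice in auto)
  finally show ?thesis .
qed

end

section \<open>Evaluating tropical rational functions\<close>

text \<open>
  The value of a monomial at the exponents \<open>k\<close> in the min-plus semiring.
\<close>

definition monom_weight :: "('a \<Rightarrow> nat) \<Rightarrow> ('a \<Rightarrow>\<^sub>0 nat) \<Rightarrow> nat" where
  "monom_weight k m = (\<Sum>v\<in>Poly_Mapping.keys m. k v * Poly_Mapping.lookup m v)"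

lemma monom_weight_superset:
  assumes "finite A" "Poly_Mapping.keys m \<subseteq> A"
  shows "monom_weight k m = (\<Sum>v\<in>A. k v * Poly_Mapping.lookup m v)"
  unfolding monom_weight_def using assms by (intro sum.mono_neutral_left) (auto simp: in_keys_iff)

lemma monom_weight_add: "monom_weight k (m + m') = monom_weight k m + monom_weight k m'"
proof -
  let ?A = "Poly_Mapping.keys m \<union> Poly_Mapping.keys m'"
  have "monom_weight k l = (\<Sum>v\<in>?A. k v * Poly_Mapping.lookup l v)" if "l \<in> {m, m', m + m'}" for l
    using that keys_add[of m m'] by (intro monom_weight_superset) auto
  thus ?thesis by (simp add: lookup_add sum.distrib distrib_left)
qed

definition set_monom :: "'a set \<Rightarrow> 'a \<Rightarrow>\<^sub>0 nat" where
  "set_monom A = (\<Sum>v\<in>A. Poly_Mapping.single v 1)"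

lemma monom_weight_sum: "monom_weight k (sum f A) = (\<Sum>a\<in>A. monom_weight k (f a))"
  by (induction A rule: infinite_finite_induct)
    (auto simp: monom_weight_add, auto simp: monom_weight_def)

lemma monom_weight_set_monom: "monom_weight k (set_monom A) = sum k A"
  unfolding set_monom_def monom_weight_sum by (simp add: monom_weight_def)

lemma keys_sum_nat_subset:
  fixes f :: "'b \<Rightarrow> ('a \<Rightarrow>\<^sub>0 nat)"
  assumes "\<And>a. a \<in> A \<Longrightarrow> Poly_Mapping.keys (f a) \<subseteq> B"
  shows "Poly_Mapping.keys (sum f A) \<subseteq> B"
  using assms
proof (induction A rule: infinite_finite_induct)
  case (insert a A)
  thus ?case using keys_add[of "f a" "sum f A"] by auto
qed auto

lemma keys_set_monom: "Poly_Mapping.keys (set_monom A) \<subseteq> A"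
  unfolding set_monom_def by (rule keys_sum_nat_subset) auto

lemma trop_min_simps:
  "carrier trop_min = - {-\<infinity>}" "x \<otimes>\<^bsub>trop_min\<^esub> y = x + y" "x \<oplus>\<^bsub>trop_min\<^esub> y = min x y"
  "\<one>\<^bsub>trop_min\<^esub> = Fin 0" "\<zero>\<^bsub>trop_min\<^esub> = \<infinity>"
  by (simp_all add: trop_min_def zero_extended_def)

lemma trop_gcd_simps:
  "carrier trop_gcd = {x. x \<ge> 0}" "x \<otimes>\<^bsub>trop_gcd\<^esub> y = x * y" "x \<oplus>\<^bsub>trop_gcd\<^esub> y = rat_gcd x y"
  "\<one>\<^bsub>trop_gcd\<^esub> = 1" "\<zero>\<^bsub>trop_gcd\<^esub> = 0"
  by (simp_all add: trop_gcd_def)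

lemma comm_monoid_trop_min: "comm_monoid trop_min"
proof -
  interpret semiring trop_min by (rule semiring_trop_min)
  show ?thesis by (intro monoid_comm_monoidI) (simp add: trop_min_simps add.commute)
qed

lemma comm_monoid_trop_gcd: "comm_monoid trop_gcd"
proof -
  interpret semiring trop_gcd by (rule semiring_trop_gcd)
  show ?thesis by (intro monoid_comm_monoidI) (simp add: trop_gcd_simps mult.commute)
qed

lemma trop_min_pow: "Fin a [^]\<^bsub>trop_min\<^esub> (n::nat) = Fin (int n * a)"
  by (induction n) (simp_all add: trop_min_simps algebra_simps)

lemma trop_gcd_pow: "x [^]\<^bsub>trop_gcd\<^esub> (n::nat) = x ^ n"
  by (induction n) (simp_all add: trop_gcd_simps)

lemma eval_monom_trop_min:
  "eval_monom trop_min (\<lambda>v. Fin (int (k v))) m = Fin (int (monom_weight k m))"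
proof -
  interpret comm_monoid trop_min by (rule comm_monoid_trop_min)
  have "finprod trop_min (\<lambda>v. Fin (int (k v)) [^]\<^bsub>trop_min\<^esub> Poly_Mapping.lookup m v) A
      = Fin (int (\<Sum>v\<in>A. k v * Poly_Mapping.lookup m v))" if "finite A" for A
    using that
    by (induction A rule: finite_induct)
      (simp_all add: trop_min_pow Pi_def trop_min_simps mult.commute)
  thus ?thesis by (simp add: eval_monom_def monom_weight_def)
qed

lemma eval_monom_trop_gcd:
  "eval_monom trop_gcd (\<lambda>v. of_nat (p ^ k v)) m = of_nat (p ^ monom_weight k m)"
proof -
  interpret comm_monoid trop_gcd by (rule comm_monoid_trop_gcd)
  have "finprod trop_gcd (\<lambda>v. of_nat (p ^ k v) [^]\<^bsub>trop_gcd\<^esub> Poly_Mapping.lookup m v) A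
      = of_nat (p ^ (\<Sum>v\<in>A. k v * Poly_Mapping.lookup m v))" if "finite A" for A
    using that
    by (induction A rule: finite_induct)
      (simp_all add: trop_gcd_pow Pi_def trop_gcd_simps power_add power_mult)
  thus ?thesis by (simp add: eval_monom_def monom_weight_def)
qed

lemma eval_poly_trop_min:
  assumes "finite P" "P \<noteq> {}"
  shows "eval_poly trop_min (\<lambda>v. Fin (int (k v))) P = Fin (int (MIN m\<in>P. monom_weight k m))"
proof -
  interpret semiring trop_min by (rule semiring_trop_min)
  show ?thesis unfolding eval_poly_def eval_monom_trop_min using assms
  proof (induction P rule: finite_ne_induct)
    case (singleton m) thus ?case by (simp add: Pi_def trop_min_simps finsum_insert[of "{}"])
  next
    case (insert m P)
    thus ?case by (simp add: finsum_insert Pi_def trop_min_simps of_nat_min)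
  qed
qed

lemma trop_power_Fin: "trop_power p (Fin (int n)) = of_nat (p ^ n)"
  by (simp add: trop_power_def)

lemma eval_poly_trop_gcd:
  assumes "prime p" "finite P" "P \<noteq> {}"
  shows "eval_poly trop_gcd (\<lambda>v. of_nat (p ^ k v)) P = of_nat (p ^ (MIN m\<in>P. monom_weight k m))"
proof -
  interpret semiring trop_gcd by (rule semiring_trop_gcd)
  show ?thesis unfolding eval_poly_def eval_monom_trop_gcd using assms(2,3)
  proof (induction P rule: finite_ne_induct)
    case (singleton m)
    thus ?case using rat_gcd_zero(2)[of "of_nat (p ^ monom_weight k m)"]
      by (simp add: Pi_def trop_gcd_simps finsum_insert[of "{}"])
  next
    case (insert m P)
    let ?a = "Fin (int (monom_weight k m))" and ?b = "Fin (int (MIN m\<in>P. monom_weight k m))"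
    have "trop_power p (?a \<oplus>\<^bsub>trop_min\<^esub> ?b) = trop_power p ?a \<oplus>\<^bsub>trop_gcd\<^esub> trop_power p ?b"
      by (rule trop_power_hom[OF assms(1)]) (simp_all add: trop_min_simps)
    moreover have "?a \<oplus>\<^bsub>trop_min\<^esub> ?b = Fin (int (MIN m\<in>insert m P. monom_weight k m))"
      using insert.hyps by (simp add: trop_min_simps of_nat_min)
    ultimately show ?case using insert
      by (simp add: finsum_insert Pi_def trop_power_Fin trop_gcd_simps)
  qed
qed

lemma inv_trop_min: "inv\<^bsub>trop_min\<^esub> (Fin a) = Fin (- a)"
proof -
  interpret comm_monoid trop_min by (rule comm_monoid_trop_min)
  show ?thesis by (rule comm_inv_char) (simp_all add: trop_min_simps)
qed

lemma inv_trop_gcd: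
  assumes "a > 0"
  shows "inv\<^bsub>trop_gcd\<^esub> a = inverse a"
proof -
  interpret comm_monoid trop_gcd by (rule comm_monoid_trop_gcd)
  show ?thesis by (rule comm_inv_char) (use assms in \<open>simp_all add: trop_gcd_simps\<close>)
qed

text \<open>
  With a monomial as denominator both evaluations are powers of \<open>p\<close> with the difference of the
  minimal weight of the numerator and the weight of the denominator as exponent. The assumption makes
  this difference the natural number \<open>t\<close>.
\<close>

lemma eval_rational_trop:
  assumes "prime p" "finite P" "P \<noteq> {}" "(MIN m\<in>P. monom_weight k m) = t + monom_weight k q"
  shows "eval_rational trop_gcd (\<lambda>v. of_nat (p ^ k v)) (P, {q}) = of_nat (p ^ t)"
    and "trop_power p (eval_rational trop_min (\<lambda>v. Fin (int (k v))) (P, {q})) = of_nat (p ^ t)"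
proof -
  have p: "(of_nat (p ^ n) :: rat) > 0" for n using assms(1) prime_gt_0_nat by simp
  have "eval_rational trop_gcd (\<lambda>v. of_nat (p ^ k v)) (P, {q})
      = of_nat (p ^ (t + monom_weight k q)) * inverse (of_nat (p ^ monom_weight k q))"
    unfolding eval_rational_def fst_conv snd_conv trop_gcd_simps
      eval_poly_trop_gcd[OF assms(1-3)] assms(4)
      eval_poly_trop_gcd[OF assms(1) finite.insertI[OF finite.emptyI] insert_not_empty]
    by (simp only: inv_trop_gcd[OF p] image_insert image_empty Min_singleton)
  thus "eval_rational trop_gcd (\<lambda>v. of_nat (p ^ k v)) (P, {q}) = of_nat (p ^ t)"
    using p[of "monom_weight k q"] by (simp add: power_add)
  have "eval_rational trop_min (\<lambda>v. Fin (int (k v))) (P, {q}) = Fin (int t)"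
    unfolding eval_rational_def fst_conv snd_conv trop_min_simps
    using assms by (simp add: eval_poly_trop_min inv_trop_min)
  thus "trop_power p (eval_rational trop_min (\<lambda>v. Fin (int (k v))) (P, {q})) = of_nat (p ^ t)"
    by (simp only: trop_power_Fin)
qed

section \<open>The order of the torsion\<close>

text \<open>
  The tropical product of two sums: over the spanning sets of edges, an edge contributing the
  product of the variables of its ends, and over the vertex sets that meet every bipartite
  component.
\<close>

definition torsion_numerator :: "'a set \<Rightarrow> 'a set set \<Rightarrow> 'a trop_poly" where
  "torsion_numerator V E =
    (\<lambda>(S, C). (\<Sum>e\<in>S. set_monom e) + set_monom C) ` ({S. spanning E S} \<times> {C. meets_balanced V E C})"

lemma trop_rational_function_torsion:
  assumes "finite_simple_graph V E"
  shows "trop_rational_function V (torsion_numerator V E, {set_monom V})"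
proof -
  have fin: "finite V" "finite E" and E: "\<And>e. e \<in> E \<Longrightarrow> e \<subseteq> V"
    using assms finite_subset[of E "Pow V"] by (auto simp: finite_simple_graph_def)
  have "{S. spanning E S} \<subseteq> Pow E" "{C. meets_balanced V E C} \<subseteq> Pow V"
    by (auto simp: spanning_def meets_balanced_def)
  hence "finite {S. spanning E S}" "finite {C. meets_balanced V E C}"
    using fin by (auto intro: finite_subset)
  moreover have "Poly_Mapping.keys ((\<Sum>e\<in>S. set_monom e) + set_monom C) \<subseteq> V"
    if "spanning E S" "meets_balanced V E C" for S C
  proof -
    have "Poly_Mapping.keys (\<Sum>e\<in>S. set_monom e) \<subseteq> V"
    proof (rule keys_sum_nat_subset)
      fix e assume "e \<in> S"
      hence "e \<subseteq> V" using that(1) E by (auto simp: spanning_def)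
      thus "Poly_Mapping.keys (set_monom e) \<subseteq> V" using keys_set_monom[of e] by blast
    qed
    moreover have "Poly_Mapping.keys (set_monom C) \<subseteq> V"
      using that(2) keys_set_monom[of C] by (auto simp: meets_balanced_def)
    ultimately show ?thesis using keys_add[of "\<Sum>e\<in>S. set_monom e" "set_monom C"] by blast
  qed
  ultimately show ?thesis
    using keys_set_monom[of V]
    by (auto simp: trop_rational_function_def trop_polynomial_def torsion_numerator_def)
qed

text \<open>
  The minimum over the numerator is attained where the two bounds for the indices are, and the order
  of the torsion is the quotient of the two indices.
\<close>

lemma (in prime_weighted_graph) primary_torsion_order:
  defines "T \<equiv> primary_torsion p (graph_H1 V E (\<lambda>v. p ^ k v))"
  obtains t where "card T = p ^ t"
    "(MIN m\<in>torsion_numerator V E. monom_weight k m) = t + sum k V"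
    "finite (torsion_numerator V E)" "torsion_numerator V E \<noteq> {}"
proof -
  obtain S where S: "spanning E S" "card (coset unweighted_lattice ` cocycle_lattice) = p ^ (\<Sum>e\<in>S. sum k e)"
    by (rule index_unweighted_in_cocycle_attained)
  obtain C where C: "meets_balanced V E C" "card (coset unweighted_lattice ` coboundary_lattice) = p ^ sum k (V - C)"
    by (rule index_unweighted_in_coboundary_attained)
  have weight: "monom_weight k ((\<Sum>e\<in>S. set_monom e) + set_monom C) = (\<Sum>e\<in>S. sum k e) + sum k C" for S C
    by (simp add: monom_weight_add monom_weight_sum monom_weight_set_monom)
  have split: "sum k V = sum k (V - C) + sum k C" if "meets_balanced V E C" for C
    using that finite_V by (intro sum.subset_diff) (auto simp: meets_balanced_def)
  have fin: "finite (torsion_numerator V E)"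
    using trop_rational_function_torsion[OF graph]
    by (simp add: trop_rational_function_def trop_polynomial_def)
  have mem: "(\<Sum>e\<in>S. set_monom e) + set_monom C \<in> torsion_numerator V E"
    unfolding torsion_numerator_def using S(1) C(1) by force
  have min: "(MIN m\<in>torsion_numerator V E. monom_weight k m) = (\<Sum>e\<in>S. sum k e) + sum k C"
  proof (rule Min_eqI)
    show "(\<Sum>e\<in>S. sum k e) + sum k C \<in> monom_weight k ` torsion_numerator V E"
      using imageI[OF mem, of "monom_weight k"] by (simp only: weight)
    fix n assume "n \<in> monom_weight k ` torsion_numerator V E"
    then obtain S' C' where S': "spanning E S'" and C': "meets_balanced V E C'"
      and n: "n = (\<Sum>e\<in>S'. sum k e) + sum k C'"
      by (auto simp: torsion_numerator_def weight)
    have "(\<Sum>e\<in>S. sum k e) \<le> (\<Sum>e\<in>S'. sum k e)"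
      using index_unweighted_in_cocycle_le[OF S'] p_gt_1 unfolding S(2) by simp
    moreover have "sum k (V - C') \<le> sum k (V - C)"
      using index_unweighted_in_coboundary_ge[OF C'] p_gt_1 unfolding C(2) by simp
    ultimately show "(\<Sum>e\<in>S. sum k e) + sum k C \<le> n"
      using split[OF C(1)] split[OF C'] n by simp
  qed (use fin in simp)
  have tower: "p ^ (\<Sum>e\<in>S. sum k e) = card T * p ^ sum k (V - C)"
    using card_cosets_tower[OF add_subgroup_unweighted_lattice add_subgroup_coboundary_lattice
        add_subgroup_cocycle_lattice
        unweighted_subset_coboundary coboundary_subset_cocycle]
    unfolding S(2) C(2) T_def card_primary_torsion .
  hence "card T \<noteq> 0" using p_gt_0 by (metis mult_0 power_not_zero less_irrefl)
  hence "p ^ sum k (V - C) \<le> p ^ (\<Sum>e\<in>S. sum k e)" unfolding tower by simp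
  hence le: "sum k (V - C) \<le> (\<Sum>e\<in>S. sum k e)" using p_gt_1 by simp
  define t where "t = (\<Sum>e\<in>S. sum k e) - sum k (V - C)"
  have "p ^ t * p ^ sum k (V - C) = card T * p ^ sum k (V - C)"
    using le by (simp add: tower[symmetric] t_def flip: power_add)
  hence "card T = p ^ t" using p_gt_0 by simp
  moreover have "(MIN m\<in>torsion_numerator V E. monom_weight k m) = t + sum k V"
    unfolding min t_def using split[OF C(1)] le by simp
  ultimately show ?thesis using that fin mem by blast
qed

theorem theorem65:
  fixes V :: "'a set" and E :: "'a set set"
  assumes "finite_simple_graph V E"
  shows "\<exists>Z. trop_rational_function V Z \<and>
    (\<forall>(k :: 'a \<Rightarrow> nat) (p :: nat). prime p \<and> odd p \<longrightarrow>
      (let T = primary_torsion p (graph_H1 V E (\<lambda>v. p ^ k v)) in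
        finite T \<and>
        of_nat (card T) = eval_rational trop_gcd (\<lambda>v. of_nat (p ^ k v)) Z \<and>
        of_nat (card T) = trop_power p (eval_rational trop_min (\<lambda>v. Fin (int (k v))) Z)))"
proof (intro exI[of _ "(torsion_numerator V E, {set_monom V})"] conjI allI impI)
  show "trop_rational_function V (torsion_numerator V E, {set_monom V})"
    using assms by (rule trop_rational_function_torsion)
  fix k :: "'a \<Rightarrow> nat" and p :: nat assume p: "prime p \<and> odd p"
  interpret prime_weighted_graph V E k p by unfold_locales (use assms p in auto)
  obtain t where t: "card (primary_torsion p (graph_H1 V E (\<lambda>v. p ^ k v))) = p ^ t"
    "(MIN m\<in>torsion_numerator V E. monom_weight k m) = t + sum k V"
    "finite (torsion_numerator V E)" "torsion_numerator V E \<noteq> {}"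
    by (rule primary_torsion_order)
  have "finite (primary_torsion p (graph_H1 V E (\<lambda>v. p ^ k v)))"
    by (rule card_ge_0_finite) (use t(1) p_gt_0 in simp)
  thus "let T = primary_torsion p (graph_H1 V E (\<lambda>v. p ^ k v)) in
      finite T \<and>
      of_nat (card T) = eval_rational trop_gcd (\<lambda>v. of_nat (p ^ k v))
        (torsion_numerator V E, {set_monom V}) \<and>
      of_nat (card T) = trop_power p (eval_rational trop_min (\<lambda>v. Fin (int (k v)))
        (torsion_numerator V E, {set_monom V}))"
    using eval_rational_trop[OF prime t(3,4), of k t "set_monom V"] t(1,2)
    by (simp add: Let_def monom_weight_set_monom)
qed

end
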